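(* Let $M$ be a positive semifree binoid with finite semibasis $\{x_1,\dots,x_n\}$. There exists an isomorphism of sheaves of abelian groups on $\operatorname{Spec}^\bullet M$ \[ \bigoplus_{i=1}^n\mathcal O^*_{x_i}\longrightarrow\mathcal O^*_M . \]
   Context: A (commutative) binoid is a commutative monoid $(M,+,0)$ with an absorbing element $\infty$; $M^\bullet=M\smallsetminus\{\infty\}$ and $M^*$ is the group of units. $M$ is positive if $M^*=\{0\}$. A nonzero commutative binoid $M$ is semifree with semibasis $(a_i)_{i\in I}$ if it is generated by the $a_i$ and every element $f\in M^\bullet$ can be written uniquely as $f=\sum_{i\in I}n_ia_i$ with $n_i\in\mathbb N$, $n_i=0$ for almost all $i$. A prime ideal is a subset $\mathfrak p\ni\infty$ with $\mathfrak p+M\subseteq\mathfrak p$ and $M\smallsetminus\mathfrak p$ a submonoid; $\operatorname{Spec}M$ is the set of prime ideals with basis of open sets $D(f)=\{\mathfrak p\mid f\notin\mathfrak p\}$, $f\in M$, and $\operatorname{Spec}^\bullet M=\operatorname{Spec}M\smallsetminus\{M_+\}$ where $M_+=M\smallsetminus M^*$. The structure sheaf $\mathcal O_M$ is the sheaf of binoids on $\operatorname{Spec}M$ with $\mathcal O_M(D(f))=M_f$, and $\mathcal O_M^*$ is its sheaf of units (here restricted to $\operatorname{Spec}^\bullet M$). $\mathcal O^*_{x_i}$ is the extension by zero along the open embedding $D(x_i)\hookrightarrow\operatorname{Spec}^\bullet M$ of the constant sheaf $\mathbb Z$ on $D(x_i)$, i.e. the sheafification of the presheaf on $\operatorname{Spec}^\bullet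 M$ given by $U\mapsto\mathbb Z$ if $U\subseteq D(x_i)$ and $U\mapsto0$ otherwise. *)

theory Defs
  imports "HOL-Analysis.Abstract_Topology" "HOL-Algebra.FiniteProduct"
    "HOL-Algebra.Product_Groups"
begin

section \<open>Commutative binoids\<close>

text \<open>
  Binoids are written multiplicatively, in the style of HOL-Algebra: the operation $+$ is
  \<open>\<otimes>\<close>, the identity $0$ is \<open>\<one>\<close>, a multiple $n a$ is \<open>a [^] n\<close>, and the absorbing element
  $\infty$ is the field \<open>infty\<close>.
\<close>

record 'a binoid = "'a monoid" +
  infty :: 'a

locale comm_binoid = comm_monoid M for M :: "('a, 'm) binoid_scheme" (structure) +
  assumes infty_closed [simp, intro]: "infty M \<in> carrier M"
    and infty_absorb [simp]: "a \<in> carrier M \<Longrightarrow> infty M \<otimes> a = infty M"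

definition binoid_hom ::
    "('a, 'm) binoid_scheme \<Rightarrow> ('b, 'n) binoid_scheme \<Rightarrow> ('a \<Rightarrow> 'b) set" where
  "binoid_hom M N =
     {h \<in> hom M N. h \<one>\<^bsub>M\<^esub> = \<one>\<^bsub>N\<^esub> \<and> h (infty M) = infty N}"

definition positive_binoid :: "('a, 'm) binoid_scheme \<Rightarrow> bool" where
  "positive_binoid M \<longleftrightarrow> Units M = {\<one>\<^bsub>M\<^esub>}"

definition generated_binoid :: "('a, 'm) binoid_scheme \<Rightarrow> 'a set \<Rightarrow> 'a set" where
  "generated_binoid M A = \<Inter>{N. submonoid N M \<and> infty M \<in> N \<and> A \<subseteq> N}"

text \<open>
  Exponent vectors are extensional functions on \<open>I\<close>, so that \<open>\<exists>!\<close> compares them on \<open>I\<close> only.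
\<close>

definition semifree :: "('a, 'm) binoid_scheme \<Rightarrow> 'i set \<Rightarrow> ('i \<Rightarrow> 'a) \<Rightarrow> bool" where
  "semifree M I a \<longleftrightarrow>
     \<one>\<^bsub>M\<^esub> \<noteq> infty M \<and>
     a \<in> I \<rightarrow> carrier M \<and>
     generated_binoid M (a ` I) = carrier M \<and>
     (\<forall>f \<in> carrier M - {infty M}.
        \<exists>!n :: 'i \<Rightarrow> nat. n \<in> (I \<rightarrow>\<^sub>E UNIV) \<and> finite {i \<in> I. n i \<noteq> 0} \<and>
          f = finprod M (\<lambda>i. a i [^]\<^bsub>M\<^esub> n i) {i \<in> I. n i \<noteq> 0})"


section \<open>The spectrum\<close>

definition prime_ideals :: "('a, 'm) binoid_scheme \<Rightarrow> 'a set set" where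
  "prime_ideals M =
     {p. p \<subseteq> carrier M \<and> infty M \<in> p \<and>
         (\<forall>a \<in> p. \<forall>b \<in> carrier M. a \<otimes>\<^bsub>M\<^esub> b \<in> p) \<and>
         submonoid (carrier M - p) M}"

definition basic_open :: "('a, 'm) binoid_scheme \<Rightarrow> 'a \<Rightarrow> 'a set set" where
  "basic_open M f = {p \<in> prime_ideals M. f \<notin> p}"

definition Spec :: "('a, 'm) binoid_scheme \<Rightarrow> 'a set topology" where
  "Spec M = topology_generated_by (basic_open M ` carrier M)"

definition max_ideal :: "('a, 'm) binoid_scheme \<Rightarrow> 'a set" where
  "max_ideal M = carrier M - Units M"

definition punctured_Spec :: "('a, 'm) binoid_scheme \<Rightarrow> 'a set topology" where
  "punctured_Spec M = subtopology (Spec M) (prime_ideals M - {max_ideal M})"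


section \<open>Localization\<close>

definition frac_rel ::
    "('a, 'm) binoid_scheme \<Rightarrow> 'a set \<Rightarrow> (('a \<times> 'a) \<times> ('a \<times> 'a)) set" where
  "frac_rel M S =
     {((a, s), (b, t)). a \<in> carrier M \<and> b \<in> carrier M \<and> s \<in> S \<and> t \<in> S \<and>
        (\<exists>u \<in> S. u \<otimes>\<^bsub>M\<^esub> (a \<otimes>\<^bsub>M\<^esub> t) = u \<otimes>\<^bsub>M\<^esub> (b \<otimes>\<^bsub>M\<^esub> s))}"

definition fraction ::
    "('a, 'm) binoid_scheme \<Rightarrow> 'a set \<Rightarrow> 'a \<Rightarrow> 'a \<Rightarrow> ('a \<times> 'a) set" where
  "fraction M S a s = frac_rel M S `` {(a, s)}"

definition localization ::
    "('a, 'm) binoid_scheme \<Rightarrow> 'a set \<Rightarrow> ('a \<times> 'a) set binoid" where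
  "localization M S =
     \<lparr>carrier = (carrier M \<times> S) // frac_rel M S,
      monoid.mult = (\<lambda>A B. \<Union>(a, s) \<in> A. \<Union>(b, t) \<in> B. fraction M S (a \<otimes>\<^bsub>M\<^esub> b) (s \<otimes>\<^bsub>M\<^esub> t)),
      one = fraction M S \<one>\<^bsub>M\<^esub> \<one>\<^bsub>M\<^esub>,
      infty = fraction M S (infty M) \<one>\<^bsub>M\<^esub>\<rparr>"

definition localization_at :: "('a, 'm) binoid_scheme \<Rightarrow> 'a \<Rightarrow> ('a \<times> 'a) set binoid" where
  "localization_at M f = localization M (range (\<lambda>k :: nat. f [^]\<^bsub>M\<^esub> k))"

abbreviation local_binoid :: "('a, 'm) binoid_scheme \<Rightarrow> 'a set \<Rightarrow> ('a \<times> 'a) set binoid" where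
  "local_binoid M p \<equiv> localization M (carrier M - p)"


section \<open>Presheaves and sheaves\<close>

text \<open>
  The values of a presheaf at all open sets live in one type \<open>'s\<close>; \<open>res F U V\<close> is the restriction
  from \<open>U\<close> to \<open>V\<close>. Only the values at open sets with \<open>V \<subseteq> U\<close> matter.
\<close>

record ('p, 's, 'm) presheaf_data =
  sec :: "'p set \<Rightarrow> ('s, 'm) monoid_scheme"
  res :: "'p set \<Rightarrow> 'p set \<Rightarrow> 's \<Rightarrow> 's"

locale presheaf =
  fixes X :: "'p topology" and F :: "('p, 's, 'm) presheaf_data"
  assumes res_closed:
      "\<lbrakk>openin X U; openin X V; V \<subseteq> U; s \<in> carrier (sec F U)\<rbrakk>
        \<Longrightarrow> res F U V s \<in> carrier (sec F V)"
    and res_id: "\<lbrakk>openin X U; s \<in> carrier (sec F U)\<rbrakk> \<Longrightarrow> res F U U s = s"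
    and res_comp:
      "\<lbrakk>openin X U; openin X V; openin X W; W \<subseteq> V; V \<subseteq> U; s \<in> carrier (sec F U)\<rbrakk>
        \<Longrightarrow> res F V W (res F U V s) = res F U W s"

text \<open>
  An open cover of \<open>U\<close> is a set \<open>\<V>\<close> of open sets with union \<open>U\<close>; \<open>\<V> = {}\<close> is allowed and forces
  exactly one section over \<open>{}\<close>.
\<close>

locale sheaf = presheaf +
  assumes locality:
      "\<lbrakk>\<And>V. V \<in> \<V> \<Longrightarrow> openin X V; s \<in> carrier (sec F (\<Union>\<V>)); t \<in> carrier (sec F (\<Union>\<V>));
        \<And>V. V \<in> \<V> \<Longrightarrow> res F (\<Union>\<V>) V s = res F (\<Union>\<V>) V t\<rbrakk> \<Longrightarrow> s = t"
    and gluing: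
      "\<lbrakk>\<And>V. V \<in> \<V> \<Longrightarrow> openin X V; \<And>V. V \<in> \<V> \<Longrightarrow> \<sigma> V \<in> carrier (sec F V);
        \<And>V W. \<lbrakk>V \<in> \<V>; W \<in> \<V>\<rbrakk> \<Longrightarrow> res F V (V \<inter> W) (\<sigma> V) = res F W (V \<inter> W) (\<sigma> W)\<rbrakk>
        \<Longrightarrow> \<exists>t \<in> carrier (sec F (\<Union>\<V>)). \<forall>V \<in> \<V>. res F (\<Union>\<V>) V t = \<sigma> V"

locale ab_sheaf = sheaf +
  assumes sec_comm_group: "openin X U \<Longrightarrow> comm_group (sec F U)"
    and res_hom: "\<lbrakk>openin X U; openin X V; V \<subseteq> U\<rbrakk> \<Longrightarrow> res F U V \<in> hom (sec F U) (sec F V)"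

locale binoid_sheaf = sheaf X F
  for X :: "'p topology" and F :: "('p, 's, ('s, 'm) binoid_ext) presheaf_data" +
  assumes sec_comm_binoid: "openin X U \<Longrightarrow> comm_binoid (sec F U)"
    and res_binoid_hom:
      "\<lbrakk>openin X U; openin X V; V \<subseteq> U\<rbrakk> \<Longrightarrow> res F U V \<in> binoid_hom (sec F U) (sec F V)"

definition ab_sheaf_iso ::
    "'p topology \<Rightarrow> ('p, 's, 'm) presheaf_data \<Rightarrow> ('p, 't, 'n) presheaf_data \<Rightarrow>
      ('p set \<Rightarrow> 's \<Rightarrow> 't) \<Rightarrow> bool" where
  "ab_sheaf_iso X F G \<phi> \<longleftrightarrow>
     ab_sheaf X F \<and> ab_sheaf X G \<and>
     (\<forall>U. openin X U \<longrightarrow> \<phi> U \<in> iso (sec F U) (sec G U)) \<and>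
     (\<forall>U V. openin X U \<and> openin X V \<and> V \<subseteq> U \<longrightarrow>
        (\<forall>s \<in> carrier (sec F U). \<phi> V (res F U V s) = res G U V (\<phi> U s)))"

definition germ ::
    "'p topology \<Rightarrow> ('p, 's, 'm) presheaf_data \<Rightarrow> 'p \<Rightarrow> 'p set \<Rightarrow> 's \<Rightarrow> ('p set \<times> 's) set" where
  "germ X F p U s =
     {(V, t). openin X V \<and> p \<in> V \<and> t \<in> carrier (sec F V) \<and>
        (\<exists>W. openin X W \<and> p \<in> W \<and> W \<subseteq> U \<inter> V \<and> res F U W s = res F V W t)}"

definition stalk ::
    "'p topology \<Rightarrow> ('p, 's, 'm) presheaf_data \<Rightarrow> 'p \<Rightarrow> ('p set \<times> 's) set monoid" where
  "stalk X F p =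
     \<lparr>carrier = {germ X F p U s | U s. openin X U \<and> p \<in> U \<and> s \<in> carrier (sec F U)},
      monoid.mult = (\<lambda>A B. \<Union>(U, s) \<in> A. \<Union>(V, t) \<in> B.
        germ X F p (U \<inter> V) (res F U (U \<inter> V) s \<otimes>\<^bsub>sec F (U \<inter> V)\<^esub> res F V (U \<inter> V) t)),
      one = germ X F p (topspace X) \<one>\<^bsub>sec F (topspace X)\<^esub>\<rparr>"

text \<open>The sheaf of functions into the stalks that are locally given by sections of \<open>F\<close>.\<close>

definition sheafification ::
    "'p topology \<Rightarrow> ('p, 's, 'm) presheaf_data \<Rightarrow> ('p, 'p \<Rightarrow> ('p set \<times> 's) set, unit) presheaf_data"
  where
  "sheafification X F =
     \<lparr>sec = (\<lambda>U.
        \<lparr>carrier = {\<sigma> \<in> \<Pi>\<^sub>E p \<in> U. carrier (stalk X F p).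
           \<forall>p \<in> U. \<exists>V. openin X V \<and> p \<in> V \<and> V \<subseteq> U \<and>
             (\<exists>t \<in> carrier (sec F V). \<forall>q \<in> V. \<sigma> q = germ X F q V t)},
         monoid.mult = (\<lambda>\<sigma> \<tau>. \<lambda>p \<in> U. \<sigma> p \<otimes>\<^bsub>stalk X F p\<^esub> \<tau> p),
         one = (\<lambda>p \<in> U. \<one>\<^bsub>stalk X F p\<^esub>)\<rparr>),
      res = (\<lambda>U V \<sigma>. restrict \<sigma> V)\<rparr>"

text \<open>For finite \<open>I\<close> the sectionwise direct sum is the direct sum of sheaves.\<close>

definition direct_sum ::
    "'i set \<Rightarrow> ('i \<Rightarrow> ('p, 's, 'm) presheaf_data) \<Rightarrow> ('p, 'i \<Rightarrow> 's, unit) presheaf_data" where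
  "direct_sum I F =
     \<lparr>sec = (\<lambda>U. sum_group I (\<lambda>i. sec (F i) U)),
      res = (\<lambda>U V s. \<lambda>i \<in> I. res (F i) U V (s i))\<rparr>"

definition units_presheaf ::
    "('p, 's, 'm) presheaf_data \<Rightarrow> ('p, 's, unit) presheaf_data" where
  "units_presheaf F = \<lparr>sec = (\<lambda>U. units_of (sec F U)), res = res F\<rparr>"


section \<open>The structure sheaf\<close>

text \<open>
  Sections over \<open>U\<close> are families of elements of the local binoids $M_p$, $p \in U$, that are locally
  of the form $a/f$. The facts \<open>binoid_sheaf_structure_sheaf\<close> and \<open>structure_sheaf_basic_open\<close>
  below show that this is the sheaf of binoids with value $M_f$ at $D(f)$.
\<close>

definition structure_sheaf ::
    "('a, 'm) binoid_scheme \<Rightarrow>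
      ('a set, 'a set \<Rightarrow> ('a \<times> 'a) set, ('a set \<Rightarrow> ('a \<times> 'a) set, unit) binoid_ext) presheaf_data"
  where
  "structure_sheaf M =
     \<lparr>sec = (\<lambda>U.
        \<lparr>carrier = {s \<in> \<Pi>\<^sub>E p \<in> U. carrier (local_binoid M p).
           \<forall>p \<in> U. \<exists>V. openin (Spec M) V \<and> p \<in> V \<and> V \<subseteq> U \<and>
             (\<exists>a \<in> carrier M. \<exists>f \<in> carrier M. \<forall>q \<in> V.
                f \<notin> q \<and> s q = fraction M (carrier M - q) a f)},
         monoid.mult = (\<lambda>s t. \<lambda>p \<in> U. s p \<otimes>\<^bsub>local_binoid M p\<^esub> t p),
         one = (\<lambda>p \<in> U. \<one>\<^bsub>local_binoid M p\<^esub>),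
         infty = (\<lambda>p \<in> U. infty (local_binoid M p))\<rparr>),
      res = (\<lambda>U V s. restrict s V)\<rparr>"

text \<open>
  The punctured spectrum is open in the spectrum (\<open>openin_punctured_Spec\<close> below), so restricting
  this sheaf to it only restricts the topology.
\<close>

definition units_sheaf ::
    "('a, 'm) binoid_scheme \<Rightarrow> ('a set, 'a set \<Rightarrow> ('a \<times> 'a) set, unit) presheaf_data" where
  "units_sheaf M = units_presheaf (structure_sheaf M)"


section \<open>Extension by zero of the constant sheaf of integers\<close>

text \<open>
  If \<open>U\<close> is not contained in \<open>D(f)\<close>, then \<open>0\<close> is the only section over \<open>U\<close>. Hence every restriction
  map, be it the identity of the integers or the zero map from the zero group, is \<open>s \<mapsto> s\<close>.
\<close>

definition ext_zero_presheaf ::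
    "('a, 'm) binoid_scheme \<Rightarrow> 'a \<Rightarrow> ('a set, int, unit) presheaf_data" where
  "ext_zero_presheaf M f =
     \<lparr>sec = (\<lambda>U. if U \<subseteq> basic_open M f then integer_group else singleton_group 0),
      res = (\<lambda>U V s. s)\<rparr>"

definition ext_zero_sheaf ::
    "('a, 'm) binoid_scheme \<Rightarrow> 'a \<Rightarrow>
      ('a set, 'a set \<Rightarrow> ('a set set \<times> int) set, unit) presheaf_data" where
  "ext_zero_sheaf M f = sheafification (punctured_Spec M) (ext_zero_presheaf M f)"


section \<open>The structure sheaf is the sheaf of binoids with value $M_f$ at $D(f)$\<close>

context comm_binoid
begin

lemma frac_rel_equiv:
  assumes "submonoid S M"
  shows "equiv (carrier M \<times> S) (frac_rel M S)"
proof -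
  interpret S: submonoid S M by fact
  have sub: "s \<in> S \<Longrightarrow> s \<in> carrier M" for s using S.subset by blast
  show ?thesis
  proof (rule equivI)
    show "frac_rel M S \<subseteq> (carrier M \<times> S) \<times> (carrier M \<times> S)"
      by (auto simp: frac_rel_def)
    show "refl_on (carrier M \<times> S) (frac_rel M S)"
      by (auto simp: frac_rel_def refl_on_def intro!: bexI[OF _ S.one_closed])
    show "sym (frac_rel M S)"
      unfolding frac_rel_def sym_def by auto metis
    show "trans (frac_rel M S)"
    proof (rule transI)
      fix P Q R assume PQ: "(P, Q) \<in> frac_rel M S" and QR: "(Q, R) \<in> frac_rel M S"
      obtain a s b t c r where P: "P = (a, s)" and Q: "Q = (b, t)" and R: "R = (c, r)"
        by (metis surj_pair)
      from PQ obtain u where u: "u \<in> S" "u \<otimes> (a \<otimes> t) = u \<otimes> (b \<otimes> s)"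
        and m: "a \<in> carrier M" "b \<in> carrier M" "s \<in> S" "t \<in> S"
        by (auto simp: frac_rel_def P Q)
      from QR obtain v where v: "v \<in> S" "v \<otimes> (b \<otimes> r) = v \<otimes> (c \<otimes> t)"
        and m': "c \<in> carrier M" "r \<in> S"
        by (auto simp: frac_rel_def R Q)
      note [simp] = sub u(1) v(1) m m'
      have "(u \<otimes> v \<otimes> t) \<otimes> (a \<otimes> r) = (u \<otimes> (a \<otimes> t)) \<otimes> (v \<otimes> r)"
        by (simp add: m_ac)
      also have "\<dots> = (v \<otimes> (b \<otimes> r)) \<otimes> (u \<otimes> s)"
        by (subst u(2)) (simp add: m_ac)
      also have "\<dots> = (u \<otimes> v \<otimes> t) \<otimes> (c \<otimes> s)"
        by (subst v(2)) (simp add: m_ac)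
      finally show "(P, R) \<in> frac_rel M S"
        by (auto simp: frac_rel_def P R intro!: bexI[of _ "u \<otimes> v \<otimes> t"])
    qed
  qed
qed

lemma fraction_eq_iff:
  assumes "submonoid S M" "a \<in> carrier M" "b \<in> carrier M" "s \<in> S" "t \<in> S"
  shows "fraction M S a s = fraction M S b t \<longleftrightarrow> (\<exists>u \<in> S. u \<otimes> (a \<otimes> t) = u \<otimes> (b \<otimes> s))"
  using eq_equiv_class_iff[OF frac_rel_equiv[OF assms(1)], of "(a, s)" "(b, t)"] assms
  by (auto simp: fraction_def frac_rel_def)

lemma fraction_eqI:
  assumes "submonoid S M" "a \<in> carrier M" "b \<in> carrier M" "s \<in> S" "t \<in> S" "a \<otimes> t = b \<otimes> s"
  shows "fraction M S a s = fraction M S b t"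
  unfolding fraction_eq_iff[OF assms(1-5)] using assms submonoid.one_closed[OF assms(1)] by force

lemma carrier_localization:
  "carrier (localization M S) = {fraction M S a s | a s. a \<in> carrier M \<and> s \<in> S}"
  by (auto simp: localization_def fraction_def quotient_def)

lemma fraction_closed [intro]:
  "\<lbrakk>a \<in> carrier M; s \<in> S\<rbrakk> \<Longrightarrow> fraction M S a s \<in> carrier (localization M S)"
  by (auto simp: carrier_localization)

lemma mem_fraction:
  assumes "submonoid S M" "a \<in> carrier M" "s \<in> S"
  shows "(b, t) \<in> fraction M S a s \<longleftrightarrow>
    b \<in> carrier M \<and> t \<in> S \<and> fraction M S b t = fraction M S a s"
proof
  assume "(b, t) \<in> fraction M S a s"
  then have *: "((a, s), (b, t)) \<in> frac_rel M S" by (simp add: fraction_def)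
  then have "frac_rel M S `` {(a, s)} = frac_rel M S `` {(b, t)}"
    by (rule equiv_class_eq[OF frac_rel_equiv[OF assms(1)]])
  with * show "b \<in> carrier M \<and> t \<in> S \<and> fraction M S b t = fraction M S a s"
    by (auto simp: fraction_def frac_rel_def)
next
  assume *: "b \<in> carrier M \<and> t \<in> S \<and> fraction M S b t = fraction M S a s"
  then have "((b, t), (b, t)) \<in> frac_rel M S"
    using frac_rel_equiv[OF assms(1)] by (auto simp: equiv_def refl_on_def)
  with * show "(b, t) \<in> fraction M S a s" by (auto simp: fraction_def)
qed

lemma mult_fraction:
  assumes S: "submonoid S M" and m: "a \<in> carrier M" "b \<in> carrier M" "s \<in> S" "t \<in> S"
  shows "fraction M S a s \<otimes>\<^bsub>localization M S\<^esub> fraction M S b t = fraction M S (a \<otimes> b) (s \<otimes> t)"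
proof -
  interpret S: submonoid S M by fact
  have sub: "s \<in> S \<Longrightarrow> s \<in> carrier M" for s using S.subset by blast
  have eq: "fraction M S (a' \<otimes> b') (s' \<otimes> t') = fraction M S (a \<otimes> b) (s \<otimes> t)"
    if "(a', s') \<in> fraction M S a s" "(b', t') \<in> fraction M S b t" for a' s' b' t'
  proof -
    from that have m': "a' \<in> carrier M" "b' \<in> carrier M" "s' \<in> S" "t' \<in> S"
      and e: "fraction M S a' s' = fraction M S a s" "fraction M S b' t' = fraction M S b t"
      using mem_fraction[OF S] m by auto
    note [simp] = sub m m'
    from e obtain u v where u: "u \<in> S" "u \<otimes> (a' \<otimes> s) = u \<otimes> (a \<otimes> s')"
      and v: "v \<in> S" "v \<otimes> (b' \<otimes> t) = v \<otimes> (b \<otimes> t')"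
      using fraction_eq_iff[OF S] m m' by auto
    note [simp] = u(1) v(1)
    have "(u \<otimes> v) \<otimes> ((a' \<otimes> b') \<otimes> (s \<otimes> t)) = (u \<otimes> (a' \<otimes> s)) \<otimes> (v \<otimes> (b' \<otimes> t))"
      by (simp add: m_ac)
    also have "\<dots> = (u \<otimes> v) \<otimes> ((a \<otimes> b) \<otimes> (s' \<otimes> t'))"
      unfolding u(2) v(2) by (simp add: m_ac)
    finally show ?thesis
      using fraction_eq_iff[OF S, of "a' \<otimes> b'" "a \<otimes> b" "s' \<otimes> t'" "s \<otimes> t"]
      by (auto intro!: bexI[of _ "u \<otimes> v"])
  qed
  let ?A = "fraction M S a s" and ?B = "fraction M S b t" and ?C = "fraction M S (a \<otimes> b) (s \<otimes> t)"
  have ne: "?A \<noteq> {}" "?B \<noteq> {}"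
    using m mem_fraction[OF S] by blast+
  have "(\<Union>(a', s') \<in> ?A. \<Union>(b', t') \<in> ?B. fraction M S (a' \<otimes> b') (s' \<otimes> t')) =
      (\<Union>P \<in> ?A. \<Union>Q \<in> ?B. ?C)"
    using eq[of "fst P" "snd P" "fst Q" "snd Q" for P Q] by (simp add: case_prod_beta cong: SUP_cong)
  also have "\<dots> = ?C" using ne by simp
  finally have "(\<Union>(a', s') \<in> ?A. \<Union>(b', t') \<in> ?B. fraction M S (a' \<otimes> b') (s' \<otimes> t')) = ?C" .
  then show ?thesis by (simp add: localization_def)
qed

lemma one_localization: "\<one>\<^bsub>localization M S\<^esub> = fraction M S \<one> \<one>"
  and infty_localization: "infty (localization M S) = fraction M S (infty M) \<one>"
  by (simp_all add: localization_def)

lemma comm_binoid_localization: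
  assumes S: "submonoid S M"
  shows "comm_binoid (localization M S)"
proof -
  interpret S: submonoid S M by fact
  have sub [simp]: "s \<in> S \<Longrightarrow> s \<in> carrier M" for s using S.subset by blast
  let ?L = "localization M S"
  have "comm_monoid ?L"
  proof (rule comm_monoidI)
    fix x y z assume "x \<in> carrier ?L" "y \<in> carrier ?L" "z \<in> carrier ?L"
    then obtain a s b t c r where xyz: "x = fraction M S a s" "y = fraction M S b t" "z = fraction M S c r"
      and m: "a \<in> carrier M" "s \<in> S" "b \<in> carrier M" "t \<in> S" "c \<in> carrier M" "r \<in> S"
      unfolding carrier_localization by blast
    show "x \<otimes>\<^bsub>?L\<^esub> y \<in> carrier ?L"
      using m by (simp add: xyz mult_fraction[OF S] fraction_closed)
    show "x \<otimes>\<^bsub>?L\<^esub> y = y \<otimes>\<^bsub>?L\<^esub> x"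
      using m by (simp add: xyz mult_fraction[OF S] m_comm)
    show "x \<otimes>\<^bsub>?L\<^esub> y \<otimes>\<^bsub>?L\<^esub> z = x \<otimes>\<^bsub>?L\<^esub> (y \<otimes>\<^bsub>?L\<^esub> z)"
      using m by (simp add: xyz mult_fraction[OF S] m_assoc)
    show "\<one>\<^bsub>?L\<^esub> \<otimes>\<^bsub>?L\<^esub> x = x"
      using m by (simp add: xyz one_localization mult_fraction[OF S])
  next
    show "\<one>\<^bsub>?L\<^esub> \<in> carrier ?L" unfolding one_localization by (simp add: fraction_closed)
  qed
  moreover have "infty ?L \<in> carrier ?L" unfolding infty_localization by (simp add: fraction_closed)
  moreover have "infty ?L \<otimes>\<^bsub>?L\<^esub> x = infty ?L" if "x \<in> carrier ?L" for x
  proof -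
    from that obtain a s where x: "x = fraction M S a s" "a \<in> carrier M" "s \<in> S"
      unfolding carrier_localization by blast
    then have "fraction M S (infty M) s = fraction M S (infty M) \<one>"
      by (intro fraction_eqI[OF S]) auto
    with x show ?thesis unfolding infty_localization by (simp add: mult_fraction[OF S])
  qed
  ultimately show ?thesis
    by (simp add: comm_binoid_def comm_binoid_axioms_def)
qed

lemma submonoid_compl_prime: "p \<in> prime_ideals M \<Longrightarrow> submonoid (carrier M - p) M"
  by (simp add: prime_ideals_def)

lemma submonoid_powers: "f \<in> carrier M \<Longrightarrow> submonoid (range (\<lambda>k :: nat. f [^] k)) M"
  by (rule submonoid.intro) (auto simp: nat_pow_mult intro: range_eqI[of _ _ "0::nat"])

lemma topspace_Spec [simp]: "topspace (Spec M) = prime_ideals M"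
proof -
  have "\<one> \<notin> p" if "p \<in> prime_ideals M" for p
    using submonoid.one_closed[OF submonoid_compl_prime[OF that]] by simp
  then show ?thesis
    by (auto simp: Spec_def basic_open_def)
qed

lemma openin_basic_open: "f \<in> carrier M \<Longrightarrow> openin (Spec M) (basic_open M f)"
  by (simp add: Spec_def topology_generated_by_Basis)

lemma not_in_prime_dvd:
  assumes "p \<in> prime_ideals M" "a \<in> carrier M" "b \<in> carrier M" "a \<otimes> b \<notin> p"
  shows "a \<notin> p" "b \<notin> p"
  using assms by (auto simp: prime_ideals_def m_comm)

lemma openin_punctured_Spec: "openin (Spec M) (prime_ideals M - {max_ideal M})"
proof -
  have "prime_ideals M - {max_ideal M} = (\<Union>f \<in> max_ideal M. basic_open M f)"
  proof (intro equalityI subsetI)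
    fix p assume p: "p \<in> prime_ideals M - {max_ideal M}"
    then have "\<one> \<notin> p" "p \<subseteq> carrier M"
      using submonoid.one_closed[OF submonoid_compl_prime] by (auto simp: prime_ideals_def)
    moreover have "u \<notin> p" if u: "u \<in> Units M" for u
      using not_in_prime_dvd(1)[of p u "inv u"] p \<open>\<one> \<notin> p\<close> u Units_closed[OF u] by simp
    ultimately have "p \<subseteq> max_ideal M" by (auto simp: max_ideal_def)
    with p show "p \<in> (\<Union>f \<in> max_ideal M. basic_open M f)"
      by (auto simp: basic_open_def)
  qed (auto simp: basic_open_def)
  then show ?thesis
    by (auto simp: max_ideal_def intro!: openin_Union openin_basic_open)
qed

text \<open>
  If $f$ is not nilpotent, then $D(f)$ has a unique closed point, and every neighbourhood of that
  point contains $D(f)$.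
\<close>

lemma basic_open_closed_point:
  assumes f: "f \<in> carrier M" and not_nilpotent: "\<And>k :: nat. f [^] k \<noteq> infty M"
  obtains c where "c \<in> basic_open M f"
    and "\<And>V. \<lbrakk>openin (Spec M) V; c \<in> V\<rbrakk> \<Longrightarrow> basic_open M f \<subseteq> V"
    and "\<And>h. \<lbrakk>h \<in> carrier M; h \<notin> c\<rbrakk> \<Longrightarrow> \<exists>k :: nat. \<exists>g \<in> carrier M. f [^] k = h \<otimes> g"
proof
  define c where "c = {h \<in> carrier M. \<nexists>k :: nat. \<exists>g \<in> carrier M. f [^] k = h \<otimes> g}"
  have pow: "f [^] (k :: nat) \<notin> q" if "q \<in> prime_ideals M" "f \<notin> q" for k q
  proof -
    note S = submonoid_compl_prime[OF that(1)]
    have "f [^] k \<in> carrier M - q"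
      using that f submonoid.m_closed[OF S] submonoid.one_closed[OF S] by (induction k) auto
    then show ?thesis by auto
  qed
  have "infty M \<in> c"
    using not_nilpotent by (simp add: c_def)
  moreover have "a \<otimes> b \<in> c" if "a \<in> c" "b \<in> carrier M" for a b
    using that by (auto simp: c_def m_assoc)
  moreover have "submonoid (carrier M - c) M"
  proof
    fix a b assume ab: "a \<in> carrier M - c" "b \<in> carrier M - c"
    then obtain k l :: nat and g h where *: "f [^] k = a \<otimes> g" "f [^] l = b \<otimes> h"
      and m: "a \<in> carrier M" "b \<in> carrier M" "g \<in> carrier M" "h \<in> carrier M"
      by (auto simp: c_def)
    have "f [^] (k + l) = (a \<otimes> b) \<otimes> (g \<otimes> h)"
      using m f by (simp add: nat_pow_mult[symmetric] * m_ac)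
    with m show "a \<otimes> b \<in> carrier M - c" by (auto simp: c_def)
  next
    show "\<one> \<in> carrier M - c" by (auto simp: c_def intro!: exI[of _ "0::nat"])
  qed auto
  ultimately have "c \<in> prime_ideals M"
    by (auto simp: prime_ideals_def c_def)
  moreover have "f \<notin> c"
    using f by (auto simp: c_def intro!: exI[of _ "1::nat"] bexI[of _ \<one>])
  ultimately show "c \<in> basic_open M f" by (simp add: basic_open_def)
  show "\<exists>k :: nat. \<exists>g \<in> carrier M. f [^] k = h \<otimes> g" if "h \<in> carrier M" "h \<notin> c" for h
    using that by (simp add: c_def)
  fix V assume "openin (Spec M) V" "c \<in> V"
  then have "generate_topology_on (basic_open M ` carrier M) V" "c \<in> V"
    by (simp_all add: Spec_def openin_topology_generated_by)
  then show "basic_open M f \<subseteq> V"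
  proof induction
    case (Basis s)
    then obtain h where h: "h \<in> carrier M" "s = basic_open M h" by auto
    with Basis.prems obtain k :: nat and g where g: "g \<in> carrier M" "f [^] k = h \<otimes> g"
      by (auto simp: basic_open_def c_def)
    have "h \<notin> q" if "q \<in> prime_ideals M" "f \<notin> q" for q
      using pow[OF that, of k] not_in_prime_dvd(1)[OF that(1) h(1) g(1)] g(2) by simp
    then show ?case
      unfolding h(2) by (auto simp: basic_open_def)
  qed auto
qed

lemma carrier_structure_sheaf:
  "s \<in> carrier (sec (structure_sheaf M) U) \<longleftrightarrow>
     s \<in> (\<Pi>\<^sub>E p \<in> U. carrier (local_binoid M p)) \<and>
     (\<forall>p \<in> U. \<exists>V. openin (Spec M) V \<and> p \<in> V \<and> V \<subseteq> U \<and>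
        (\<exists>a \<in> carrier M. \<exists>f \<in> carrier M. \<forall>q \<in> V.
           f \<notin> q \<and> s q = fraction M (carrier M - q) a f))"
  by (simp add: structure_sheaf_def)

lemma structure_sheaf_simps:
  "s \<otimes>\<^bsub>sec (structure_sheaf M) U\<^esub> t = (\<lambda>p \<in> U. s p \<otimes>\<^bsub>local_binoid M p\<^esub> t p)"
  "\<one>\<^bsub>sec (structure_sheaf M) U\<^esub> = (\<lambda>p \<in> U. \<one>\<^bsub>local_binoid M p\<^esub>)"
  "infty (sec (structure_sheaf M) U) = (\<lambda>p \<in> U. infty (local_binoid M p))"
  "res (structure_sheaf M) U V s = restrict s V"
  by (simp_all add: structure_sheaf_def)

lemma fraction_section:
  assumes "openin (Spec M) U" "a \<in> carrier M" "f \<in> carrier M" "\<And>q. q \<in> U \<Longrightarrow> f \<notin> q"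
  shows "(\<lambda>p \<in> U. fraction M (carrier M - p) a f) \<in> carrier (sec (structure_sheaf M) U)"
  unfolding carrier_structure_sheaf using assms by (auto intro!: exI[of _ U])

lemma restrict_section:
  assumes "openin (Spec M) V" "V \<subseteq> U" "s \<in> carrier (sec (structure_sheaf M) U)"
  shows "restrict s V \<in> carrier (sec (structure_sheaf M) V)"
  unfolding carrier_structure_sheaf
proof (intro conjI ballI)
  show "restrict s V \<in> (\<Pi>\<^sub>E p \<in> V. carrier (local_binoid M p))"
    using assms by (auto simp: carrier_structure_sheaf)
  fix p assume "p \<in> V"
  then obtain W a f where "openin (Spec M) W" "p \<in> W" "W \<subseteq> U" "a \<in> carrier M" "f \<in> carrier M"
    "\<forall>q \<in> W. f \<notin> q \<and> s q = fraction M (carrier M - q) a f"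
    using assms unfolding carrier_structure_sheaf by (meson subsetD)
  moreover from this have "\<forall>q \<in> V \<inter> W. f \<notin> q \<and> restrict s V q = fraction M (carrier M - q) a f"
    by simp
  ultimately show "\<exists>W. openin (Spec M) W \<and> p \<in> W \<and> W \<subseteq> V \<and>
      (\<exists>a \<in> carrier M. \<exists>f \<in> carrier M. \<forall>q \<in> W.
        f \<notin> q \<and> restrict s V q = fraction M (carrier M - q) a f)"
    using openin_Int[OF assms(1)] \<open>p \<in> V\<close> by (meson IntI Int_lower1)
qed

lemma comm_binoid_sections:
  assumes U: "openin (Spec M) U"
  shows "comm_binoid (sec (structure_sheaf M) U)"
proof -
  let ?O = "sec (structure_sheaf M) U"
  have prime: "p \<in> prime_ideals M" if "p \<in> U" for p
    using openin_subset[OF U] that by auto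
  have loc: "comm_binoid (local_binoid M p)" if "p \<in> U" for p
    using comm_binoid_localization submonoid_compl_prime prime that by blast
  have cm: "comm_monoid (local_binoid M p)" if "p \<in> U" for p
    using loc[OF that] by (rule comm_binoid.axioms)
  have mon: "monoid (local_binoid M p)" if "p \<in> U" for p
    using cm[OF that] by (rule comm_monoid.axioms)
  have val: "s p \<in> carrier (local_binoid M p)" if "s \<in> carrier ?O" "p \<in> U" for s p
    using that by (auto simp: carrier_structure_sheaf)
  have ext: "s \<in> extensional U" if "s \<in> carrier ?O" for s
    using that by (auto simp: carrier_structure_sheaf PiE_def)
  have closed: "s \<otimes>\<^bsub>?O\<^esub> t \<in> carrier ?O" if st: "s \<in> carrier ?O" "t \<in> carrier ?O" for s t
    unfolding carrier_structure_sheaf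
  proof (intro conjI ballI)
    show "s \<otimes>\<^bsub>?O\<^esub> t \<in> (\<Pi>\<^sub>E p \<in> U. carrier (local_binoid M p))"
      using st by (auto simp: structure_sheaf_simps intro!: monoid.m_closed mon val[OF st(1)] val[OF st(2)])
    fix p assume p: "p \<in> U"
    obtain V a f where V: "openin (Spec M) V" "p \<in> V" "V \<subseteq> U" "a \<in> carrier M" "f \<in> carrier M"
      "\<forall>q \<in> V. f \<notin> q \<and> s q = fraction M (carrier M - q) a f"
      using st(1) p unfolding carrier_structure_sheaf by meson
    obtain W b g where W: "openin (Spec M) W" "p \<in> W" "W \<subseteq> U" "b \<in> carrier M" "g \<in> carrier M"
      "\<forall>q \<in> W. g \<notin> q \<and> t q = fraction M (carrier M - q) b g"
      using st(2) p unfolding carrier_structure_sheaf by meson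
    have *: "f \<otimes> g \<notin> q \<and> (s \<otimes>\<^bsub>?O\<^esub> t) q = fraction M (carrier M - q) (a \<otimes> b) (f \<otimes> g)"
      if q: "q \<in> V \<inter> W" for q
    proof -
      have S: "submonoid (carrier M - q) M" using q V prime submonoid_compl_prime by blast
      have "f \<in> carrier M - q" "g \<in> carrier M - q" using q V W by auto
      with submonoid.m_closed[OF S this] show ?thesis
        using q V W by (auto simp: structure_sheaf_simps mult_fraction[OF S])
    qed
    have "openin (Spec M) (V \<inter> W)" "p \<in> V \<inter> W" "V \<inter> W \<subseteq> U" "a \<otimes> b \<in> carrier M" "f \<otimes> g \<in> carrier M"
      using V W by auto
    then show "\<exists>V. openin (Spec M) V \<and> p \<in> V \<and> V \<subseteq> U \<and>
        (\<exists>a \<in> carrier M. \<exists>f \<in> carrier M. \<forall>q \<in> V.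
          f \<notin> q \<and> (s \<otimes>\<^bsub>?O\<^esub> t) q = fraction M (carrier M - q) a f)"
      using * by metis
  qed
  have one_notin: "\<one> \<notin> p" if "p \<in> U" for p
    using submonoid.one_closed[OF submonoid_compl_prime[OF prime[OF that]]] by simp
  have one: "\<one>\<^bsub>?O\<^esub> \<in> carrier ?O"
    using fraction_section[OF U one_closed one_closed] one_notin
    by (simp add: structure_sheaf_simps one_localization)
  have inf: "infty ?O \<in> carrier ?O"
    using fraction_section[OF U infty_closed one_closed] one_notin
    by (simp add: structure_sheaf_simps infty_localization)
  have "comm_monoid ?O"
  proof (rule comm_monoidI)
    fix s t r assume st: "s \<in> carrier ?O" "t \<in> carrier ?O" "r \<in> carrier ?O"
    note v = st[THEN val]
    show "s \<otimes>\<^bsub>?O\<^esub> t \<otimes>\<^bsub>?O\<^esub> r = s \<otimes>\<^bsub>?O\<^esub> (t \<otimes>\<^bsub>?O\<^esub> r)"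
      unfolding structure_sheaf_simps
      by (rule restrict_ext) (simp add: monoid.m_assoc[OF mon v])
    show "s \<otimes>\<^bsub>?O\<^esub> t = t \<otimes>\<^bsub>?O\<^esub> s"
      unfolding structure_sheaf_simps
      by (rule restrict_ext) (rule comm_monoid.m_comm[OF cm v(1,2)])
    show "\<one>\<^bsub>?O\<^esub> \<otimes>\<^bsub>?O\<^esub> s = s"
      by (rule extensionalityI[OF _ ext[OF st(1)]])
        (simp_all add: structure_sheaf_simps monoid.l_one[OF mon v(1)])
  qed (use closed one in auto)
  moreover have "infty ?O \<otimes>\<^bsub>?O\<^esub> s = infty ?O" if "s \<in> carrier ?O" for s
    unfolding structure_sheaf_simps
    by (rule restrict_ext) (simp add: comm_binoid.infty_absorb[OF loc val[OF that]])
  ultimately show ?thesis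
    using inf by (simp add: comm_binoid_def comm_binoid_axioms_def)
qed

theorem binoid_sheaf_structure_sheaf: "binoid_sheaf (Spec M) (structure_sheaf M)"
proof -
  let ?O = "structure_sheaf M"
  have ext: "s \<in> extensional U" if "s \<in> carrier (sec ?O U)" for s U
    using that by (auto simp: carrier_structure_sheaf PiE_def)
  have "presheaf (Spec M) ?O"
  proof (rule presheaf.intro)
    fix U V s
    assume "openin (Spec M) V" "V \<subseteq> U" "s \<in> carrier (sec ?O U)"
    then show "res ?O U V s \<in> carrier (sec ?O V)"
      by (simp add: structure_sheaf_simps restrict_section)
  next
    fix U s assume "s \<in> carrier (sec ?O U)"
    then show "res ?O U U s = s"
      using ext by (simp add: structure_sheaf_simps extensional_restrict)
  next
    fix U V W :: "'a set set" and s assume "W \<subseteq> V"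
    then show "res ?O V W (res ?O U V s) = res ?O U W s"
      by (simp add: structure_sheaf_simps Int_absorb1)
  qed
  moreover have "sheaf_axioms (Spec M) ?O"
  proof (rule sheaf_axioms.intro)
    fix \<V> s t
    assume st: "s \<in> carrier (sec ?O (\<Union>\<V>))" "t \<in> carrier (sec ?O (\<Union>\<V>))"
      and eq: "\<And>V. V \<in> \<V> \<Longrightarrow> res ?O (\<Union>\<V>) V s = res ?O (\<Union>\<V>) V t"
    show "s = t"
    proof (rule extensionalityI[OF ext[OF st(1)] ext[OF st(2)]])
      fix p assume "p \<in> \<Union>\<V>"
      then obtain V where V: "V \<in> \<V>" "p \<in> V" by blast
      from fun_cong[OF eq[OF V(1)], of p] V show "s p = t p"
        by (simp add: structure_sheaf_simps)
    qed
  next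
    fix \<V> \<sigma>
    assume \<sigma>: "\<And>V. V \<in> \<V> \<Longrightarrow> \<sigma> V \<in> carrier (sec ?O V)"
      and compat: "\<And>V W. \<lbrakk>V \<in> \<V>; W \<in> \<V>\<rbrakk> \<Longrightarrow>
        res ?O V (V \<inter> W) (\<sigma> V) = res ?O W (V \<inter> W) (\<sigma> W)"
    define t where "t = (\<lambda>p \<in> \<Union>\<V>. \<sigma> (SOME V. V \<in> \<V> \<and> p \<in> V) p)"
    have t: "t p = \<sigma> V p" if "V \<in> \<V>" "p \<in> V" for p V
    proof -
      let ?W = "SOME V. V \<in> \<V> \<and> p \<in> V"
      have W: "?W \<in> \<V> \<and> p \<in> ?W" by (rule someI[of _ V]) (use that in auto)
      from fun_cong[OF compat[OF that(1) W[THEN conjunct1]], of p] W that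
      have "\<sigma> ?W p = \<sigma> V p" by (simp add: structure_sheaf_simps)
      moreover have "p \<in> \<Union>\<V>" using that by blast
      ultimately show ?thesis by (simp add: t_def)
    qed
    have "t \<in> carrier (sec ?O (\<Union>\<V>))"
      unfolding carrier_structure_sheaf
    proof (intro conjI ballI PiE_I)
      fix p assume "p \<in> \<Union>\<V>"
      then obtain V where V: "V \<in> \<V>" "p \<in> V" by blast
      have "\<sigma> V p \<in> carrier (local_binoid M p)"
        using \<sigma>[OF V(1)] V(2) by (auto simp: carrier_structure_sheaf)
      then show "t p \<in> carrier (local_binoid M p)" using t[OF V] by simp
    next
      fix p assume "p \<in> \<Union>\<V>"
      then obtain V where V: "V \<in> \<V>" "p \<in> V" by blast
      obtain W a f where W: "openin (Spec M) W" "p \<in> W" "W \<subseteq> V"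
        "a \<in> carrier M" "f \<in> carrier M" "\<forall>q \<in> W. f \<notin> q \<and> \<sigma> V q = fraction M (carrier M - q) a f"
        using \<sigma>[OF V(1)] V(2) unfolding carrier_structure_sheaf by meson
      have "W \<subseteq> \<Union>\<V>" using V(1) W(3) by blast
      moreover have "\<forall>q \<in> W. f \<notin> q \<and> t q = fraction M (carrier M - q) a f"
        using t[OF V(1)] W(3,6) by (metis subsetD)
      ultimately show "\<exists>W. openin (Spec M) W \<and> p \<in> W \<and> W \<subseteq> \<Union>\<V> \<and>
          (\<exists>a \<in> carrier M. \<exists>f \<in> carrier M. \<forall>q \<in> W.
            f \<notin> q \<and> t q = fraction M (carrier M - q) a f)"
        using W(1,2,4,5) by metis
    next
      fix p assume "p \<notin> \<Union>\<V>"
      then show "t p = undefined" by (simp add: t_def)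
    qed
    moreover have "res ?O (\<Union>\<V>) V t = \<sigma> V" if "V \<in> \<V>" for V
      unfolding structure_sheaf_simps
    proof (rule extensionalityI[OF _ ext[OF \<sigma>[OF that]]])
      show "restrict t V p = \<sigma> V p" if "p \<in> V" for p
        using t[OF \<open>V \<in> \<V>\<close> that] that by simp
    qed simp
    ultimately show "\<exists>t \<in> carrier (sec ?O (\<Union>\<V>)). \<forall>V \<in> \<V>. res ?O (\<Union>\<V>) V t = \<sigma> V"
      by blast
  qed
  moreover have "res ?O U V \<in> binoid_hom (sec ?O U) (sec ?O V)"
    if "openin (Spec M) U" "openin (Spec M) V" "V \<subseteq> U" for U V
  proof -
    have "restrict (restrict g U) V = restrict g V" for g :: "'a set \<Rightarrow> ('a \<times> 'a) set"
      using that(3) by (simp add: Int_absorb1)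
    moreover have "restrict s V \<otimes>\<^bsub>sec ?O V\<^esub> restrict t V = restrict (s \<otimes>\<^bsub>sec ?O U\<^esub> t) V" for s t
      unfolding structure_sheaf_simps calculation by (rule restrict_ext) simp
    ultimately show ?thesis
      using that restrict_section
      by (simp add: binoid_hom_def hom_def structure_sheaf_simps(2-4) Pi_def)
  qed
  ultimately show ?thesis
    using comm_binoid_sections
    by (simp add: binoid_sheaf_def sheaf_def binoid_sheaf_axioms_def)
qed

theorem structure_sheaf_basic_open:
  assumes f: "f \<in> carrier M"
  shows "\<exists>\<phi>. \<phi> \<in> binoid_hom (localization_at M f) (sec (structure_sheaf M) (basic_open M f)) \<and>
    bij_betw \<phi> (carrier (localization_at M f)) (carrier (sec (structure_sheaf M) (basic_open M f))) \<and>
    (\<forall>a \<in> carrier M. \<forall>k :: nat.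
       \<phi> (fraction M (range (\<lambda>k :: nat. f [^] k)) a (f [^] k)) =
         (\<lambda>p \<in> basic_open M f. fraction M (carrier M - p) a (f [^] k)))"
proof -
  define S where "S = range (\<lambda>k :: nat. f [^] k)"
  let ?D = "basic_open M f" and ?O = "structure_sheaf M"
  let ?sec = "\<lambda>(a, s). \<lambda>p \<in> ?D. fraction M (carrier M - p) a s"
  have S: "submonoid S M" unfolding S_def by (rule submonoid_powers[OF f])
  have Sc: "s \<in> carrier M" if "s \<in> S" for s using that submonoid.subset[OF S] by blast
  have powS: "f [^] k \<in> S" for k :: nat by (simp add: S_def)
  have D: "p \<in> prime_ideals M" "submonoid (carrier M - p) M" "S \<subseteq> carrier M - p"
    if "p \<in> ?D" for p
  proof -
    show p: "p \<in> prime_ideals M" and S: "submonoid (carrier M - p) M"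
      using that submonoid_compl_prime by (auto simp: basic_open_def)
    have "f [^] (k :: nat) \<in> carrier M - p" for k
      using that f submonoid.m_closed[OF S] submonoid.one_closed[OF S]
      by (induction k) (auto simp: basic_open_def)
    then show "S \<subseteq> carrier M - p" unfolding S_def by blast
  qed
  have nilpotent: "?D = {}" if k: "f [^] (k :: nat) = infty M" for k
  proof -
    have False if p: "p \<in> ?D" for p
    proof -
      have "f [^] k \<notin> p" using D(3)[OF p] powS by blast
      with D(1)[OF p] k show False by (simp add: prime_ideals_def)
    qed
    then show ?thesis by blast
  qed
  have eq_iff: "?sec (a, s) = ?sec (b, t) \<longleftrightarrow> fraction M S a s = fraction M S b t"
    if m: "a \<in> carrier M" "b \<in> carrier M" "s \<in> S" "t \<in> S" for a b s t
  proof
    assume "fraction M S a s = fraction M S b t"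
    then obtain u where u: "u \<in> S" "u \<otimes> (a \<otimes> t) = u \<otimes> (b \<otimes> s)"
      using fraction_eq_iff[OF S m] by blast
    have "fraction M (carrier M - p) a s = fraction M (carrier M - p) b t" if "p \<in> ?D" for p
      using fraction_eq_iff[OF D(2)[OF that] m(1,2), of s t] D(3)[OF that] m u by blast
    then show "?sec (a, s) = ?sec (b, t)" by (auto intro: restrict_ext)
  next
    assume eq: "?sec (a, s) = ?sec (b, t)"
    show "fraction M S a s = fraction M S b t"
    proof (cases "\<exists>k :: nat. f [^] k = infty M")
      case True
      then have "infty M \<in> S" using powS by metis
      then show ?thesis
        using fraction_eq_iff[OF S m] Sc m by (metis infty_absorb m_closed)
    next
      case False
      obtain c where c: "c \<in> ?D"
        and nbhd: "\<And>V. \<lbrakk>openin (Spec M) V; c \<in> V\<rbrakk> \<Longrightarrow> ?D \<subseteq> V"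
        and dvd: "\<And>h. \<lbrakk>h \<in> carrier M; h \<notin> c\<rbrakk> \<Longrightarrow> \<exists>k :: nat. \<exists>g \<in> carrier M. f [^] k = h \<otimes> g"
        using basic_open_closed_point[OF f] False by metis
      from fun_cong[OF eq, of c] c
      have "fraction M (carrier M - c) a s = fraction M (carrier M - c) b t" by simp
      then obtain u where u: "u \<in> carrier M - c" "u \<otimes> (a \<otimes> t) = u \<otimes> (b \<otimes> s)"
        using fraction_eq_iff[OF D(2)[OF c] m(1,2), of s t] D(3)[OF c] m by blast
      then obtain k :: nat and g where g: "g \<in> carrier M" "f [^] k = u \<otimes> g"
        using dvd[of u] by blast
      have "f [^] k \<otimes> (a \<otimes> t) = g \<otimes> (u \<otimes> (a \<otimes> t))"
        using g u(1) m Sc by (simp add: m_ac)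
      also have "\<dots> = f [^] k \<otimes> (b \<otimes> s)"
        unfolding u(2) using g u(1) m Sc by (simp add: m_ac)
      finally show ?thesis using fraction_eq_iff[OF S m] powS by blast
    qed
  qed
  have ssec: "?sec (a, s) \<in> carrier (sec ?O ?D)" if "a \<in> carrier M" "s \<in> S" for a s
    using fraction_section[OF openin_basic_open[OF f] that(1) Sc[OF that(2)]] D(3) that(2) by auto
  have surj: "\<exists>a \<in> carrier M. \<exists>s \<in> S. \<sigma> = ?sec (a, s)" if \<sigma>: "\<sigma> \<in> carrier (sec ?O ?D)" for \<sigma>
  proof (cases "\<exists>k :: nat. f [^] k = infty M")
    case True
    then have "?D = {}" using nilpotent by blast
    with \<sigma> have "\<sigma> = ?sec (\<one>, f [^] (0::nat))"
      by (auto simp: carrier_structure_sheaf restrict_def)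
    then show ?thesis using powS by blast
  next
    case False
    obtain c where c: "c \<in> ?D"
        and nbhd: "\<And>V. \<lbrakk>openin (Spec M) V; c \<in> V\<rbrakk> \<Longrightarrow> ?D \<subseteq> V"
        and dvd: "\<And>h. \<lbrakk>h \<in> carrier M; h \<notin> c\<rbrakk> \<Longrightarrow> \<exists>k :: nat. \<exists>g \<in> carrier M. f [^] k = h \<otimes> g"
        using basic_open_closed_point[OF f] False by metis
    from c obtain V a h where V: "openin (Spec M) V" "c \<in> V" "V \<subseteq> ?D"
      and ah: "a \<in> carrier M" "h \<in> carrier M"
      and *: "\<forall>q \<in> V. h \<notin> q \<and> \<sigma> q = fraction M (carrier M - q) a h"
      using \<sigma> unfolding carrier_structure_sheaf by meson
    have VD: "V = ?D" using nbhd[OF V(1,2)] V(3) by blast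
    have "h \<notin> c" using * V(2) by blast
    from dvd[OF ah(2) this] obtain k :: nat and g where g: "g \<in> carrier M" "f [^] k = h \<otimes> g"
      by blast
    have "\<sigma> q = fraction M (carrier M - q) (a \<otimes> g) (f [^] k)" if q: "q \<in> ?D" for q
    proof -
      have "f [^] k \<in> carrier M - q" using D(3)[OF q] powS by blast
      moreover have "h \<in> carrier M - q" using * VD q ah by blast
      ultimately have "fraction M (carrier M - q) a h = fraction M (carrier M - q) (a \<otimes> g) (f [^] k)"
        using g ah f by (intro fraction_eqI[OF D(2)[OF q]]) (auto simp: m_ac)
      with * VD q show ?thesis by auto
    qed
    then have "\<sigma> = ?sec (a \<otimes> g, f [^] k)"
      using \<sigma> by (intro extensionalityI[of _ ?D]) (auto simp: carrier_structure_sheaf PiE_def)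
    moreover have "a \<otimes> g \<in> carrier M" using g ah by simp
    ultimately show ?thesis using powS by blast
  qed
  define \<phi> where "\<phi> A = ?sec (SOME P. P \<in> A)" for A
  have \<phi>: "\<phi> (fraction M S a s) = ?sec (a, s)" if m: "a \<in> carrier M" "s \<in> S" for a s
  proof -
    have "(a, s) \<in> fraction M S a s" using mem_fraction[OF S m] m by simp
    then have "(SOME P. P \<in> fraction M S a s) \<in> fraction M S a s" by (rule someI)
    then obtain b t where bt: "(SOME P. P \<in> fraction M S a s) = (b, t)"
      "b \<in> carrier M" "t \<in> S" "fraction M S b t = fraction M S a s"
      using mem_fraction[OF S m] by (metis surj_pair)
    have "?sec (b, t) = ?sec (a, s)" using eq_iff[OF bt(2) m(1) bt(3) m(2)] bt(4) by blast
    then show ?thesis by (simp add: \<phi>_def bt(1))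
  qed
  have Sm: "s \<otimes> t \<in> S" if "s \<in> S" "t \<in> S" for s t
    using submonoid.m_closed[OF S] that by blast
  have oneS: "\<one> \<in> S" by (rule submonoid.one_closed[OF S])
  have "\<phi> (x \<otimes>\<^bsub>localization M S\<^esub> y) = \<phi> x \<otimes>\<^bsub>sec ?O ?D\<^esub> \<phi> y"
    if xy: "x \<in> carrier (localization M S)" "y \<in> carrier (localization M S)" for x y
  proof -
    obtain a s b t where xy: "x = fraction M S a s" "y = fraction M S b t"
      and m: "a \<in> carrier M" "s \<in> S" "b \<in> carrier M" "t \<in> S"
      using xy unfolding carrier_localization by blast
    have "fraction M (carrier M - p) (a \<otimes> b) (s \<otimes> t) =
        fraction M (carrier M - p) a s \<otimes>\<^bsub>local_binoid M p\<^esub> fraction M (carrier M - p) b t"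
      if "p \<in> ?D" for p
      using mult_fraction[OF D(2)[OF that] m(1,3)] subsetD[OF D(3)[OF that] m(2)]
          subsetD[OF D(3)[OF that] m(4)] by simp
    then have "?sec (a \<otimes> b, s \<otimes> t) = ?sec (a, s) \<otimes>\<^bsub>sec ?O ?D\<^esub> ?sec (b, t)"
      unfolding structure_sheaf_simps prod.case by (intro restrict_ext) simp
    then show ?thesis
      unfolding xy mult_fraction[OF S m(1,3,2,4)] using m Sm by (simp only: \<phi> m_closed)
  qed
  moreover have "\<phi> \<one>\<^bsub>localization M S\<^esub> = \<one>\<^bsub>sec ?O ?D\<^esub>"
    "\<phi> (infty (localization M S)) = infty (sec ?O ?D)"
    using \<phi>[OF one_closed oneS] \<phi>[OF infty_closed oneS]
    by (simp_all add: one_localization infty_localization structure_sheaf_simps)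
  moreover have "\<phi> \<in> carrier (localization M S) \<rightarrow> carrier (sec ?O ?D)"
    unfolding carrier_localization using \<phi> ssec by auto
  ultimately have "\<phi> \<in> binoid_hom (localization M S) (sec ?O ?D)"
    by (simp add: binoid_hom_def hom_def)
  moreover have "bij_betw \<phi> (carrier (localization M S)) (carrier (sec ?O ?D))"
    unfolding bij_betw_def
  proof
    show "inj_on \<phi> (carrier (localization M S))"
    proof (rule inj_onI)
      fix x y assume xy: "x \<in> carrier (localization M S)" "y \<in> carrier (localization M S)"
        and e: "\<phi> x = \<phi> y"
      obtain a s b t where xy: "x = fraction M S a s" "y = fraction M S b t"
        and m: "a \<in> carrier M" "s \<in> S" "b \<in> carrier M" "t \<in> S"
        using xy unfolding carrier_localization by blast
      have "?sec (a, s) = ?sec (b, t)"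
        using e unfolding xy \<phi>[OF m(1,2)] \<phi>[OF m(3,4)] .
      then show "x = y" unfolding xy using eq_iff[OF m(1,3,2,4)] by blast
    qed
    show "\<phi> ` carrier (localization M S) = carrier (sec ?O ?D)"
    proof
      show "\<phi> ` carrier (localization M S) \<subseteq> carrier (sec ?O ?D)"
        using \<open>\<phi> \<in> carrier (localization M S) \<rightarrow> carrier (sec ?O ?D)\<close> by blast
      show "carrier (sec ?O ?D) \<subseteq> \<phi> ` carrier (localization M S)"
      proof
        fix \<sigma> assume "\<sigma> \<in> carrier (sec ?O ?D)"
        then obtain a s where "a \<in> carrier M" "s \<in> S" "\<sigma> = ?sec (a, s)" using surj by blast
        then show "\<sigma> \<in> \<phi> ` carrier (localization M S)"
          using \<phi>[of a s] fraction_closed[of a s] by (metis imageI)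
      qed
    qed
  qed
  moreover have "\<phi> (fraction M S a (f [^] k)) = ?sec (a, f [^] k)"
    if "a \<in> carrier M" for a and k :: nat
    by (rule \<phi>[OF that powS])
  ultimately show ?thesis
    unfolding localization_at_def S_def[symmetric] prod.case by blast
qed

end

end

theory Submission
  imports Defs
begin

text \<open>
  A prime \<open>p\<close> of a semifree binoid is determined by the set $A_p$ of those \<open>i\<close> with $x_i \notin p$, and
  its complement consists of the monomials in the $x_i$, $i \in A_p$. None of these is $\infty$, so by
  uniqueness of exponents the units of $M_p$ are exactly the Laurent monomials in the $x_i$, $i \in A_p$,
  and form a free abelian group on $A_p$. A section of the extension by zero along $D(x_i)$
  is a locally constant integer $k_i$ that vanishes outside $D(x_i)$. The isomorphism sends the tuple
  $(k_i)$ to $p \mapsto \prod_i x_i^{k_i(p)}$. It is onto because a unit section is locally $a/f$ with monomials \<open>a\<close> and \<open>f\<close>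
  that avoid all primes of the neighbourhood, so that the difference of their exponents is constant
  there and vanishes at \<open>i\<close> as soon as some prime of the neighbourhood contains $x_i$.
\<close>

section \<open>Constructions of sheaves\<close>

text \<open>\<open>ab_sheaf_iso\<close> includes the sheaf axioms and the group structure for both
  sides. They therefore have to be established for units, finite direct sums and sheafifications
  before the two sheaves can be compared.

  On the binoid side the obstacle is \<open>infty M\<close>. A product of generators may be equal to
  it, so different exponent vectors can give the same element, and exponents are not a function on
  all of \<open>M\<close>. Every comparison of exponents therefore takes place off a prime, one
  prime at a time.

  The encoding of the two sheaves suits this. A section on either side is a function of the prime
  that satisfies a local condition, so the isomorphism and its inverse are described pointwise, with
  one integer vector per prime as the common datum. What remains is to match the two local
  conditions. Finiteness of the semibasis merges the neighbourhoods belonging to the single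
  coordinates into one for the whole vector.\<close>

locale ab_presheaf = presheaf +
  assumes sec_comm_group: "openin X U \<Longrightarrow> comm_group (sec F U)"
    and res_hom: "\<lbrakk>openin X U; openin X V; V \<subseteq> U\<rbrakk> \<Longrightarrow> res F U V \<in> hom (sec F U) (sec F V)"

text \<open>Open sets of an open subspace are open in the whole space, so each axiom for the
  subspace is an instance of the one for \<open>X\<close>. This carries the structure sheaf over to
  the punctured spectrum unchanged.\<close>

lemma binoid_sheaf_open_subspace:
  assumes F: "binoid_sheaf X F" and T: "openin X T"
  shows "binoid_sheaf (subtopology X T) F"
proof -
  interpret binoid_sheaf X F by fact
  note op = openin_open_subtopology[OF T]
  show ?thesis
  proof (intro binoid_sheaf.intro sheaf.intro presheaf.intro sheaf_axioms.intro binoid_sheaf_axioms.intro)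
    show "s = t"
      if "\<And>V. V \<in> \<V> \<Longrightarrow> openin (subtopology X T) V"
        "s \<in> carrier (sec F (\<Union>\<V>))" "t \<in> carrier (sec F (\<Union>\<V>))"
        "\<And>V. V \<in> \<V> \<Longrightarrow> res F (\<Union>\<V>) V s = res F (\<Union>\<V>) V t" for \<V> s t
      using that by (intro locality[of \<V> s t]) (auto simp: op)
    show "\<exists>t \<in> carrier (sec F (\<Union>\<V>)). \<forall>V \<in> \<V>. res F (\<Union>\<V>) V t = \<sigma> V"
      if "\<And>V. V \<in> \<V> \<Longrightarrow> openin (subtopology X T) V" "\<And>V. V \<in> \<V> \<Longrightarrow> \<sigma> V \<in> carrier (sec F V)"
        "\<And>V W. \<lbrakk>V \<in> \<V>; W \<in> \<V>\<rbrakk> \<Longrightarrow> res F V (V \<inter> W) (\<sigma> V) = res F W (V \<inter> W) (\<sigma> W)" for \<V> \<sigma>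
      using that by (intro gluing) (auto simp: op)
  qed (auto simp: op res_closed res_id res_comp sec_comm_binoid res_binoid_hom)
qed

text \<open>Locality is inherited from \<open>F\<close>; the point is that glued units form a unit.
  Inverses are unique and hence compatible with restriction, so the local inverses glue as well, and
  locality shows that the two glued sections multiply to the identity.\<close>

lemma ab_sheaf_units_presheaf:
  assumes "binoid_sheaf X F"
  shows "ab_sheaf X (units_presheaf F)"
proof -
  interpret binoid_sheaf X F by fact
  let ?G = "units_presheaf F"
  have sec: "sec ?G U = units_of (sec F U)" and res: "res ?G = res F" for U
    by (simp_all add: units_presheaf_def)
  have car: "carrier (sec ?G U) = Units (sec F U)" for U
    by (simp add: sec units_of_carrier)
  have cm: "comm_monoid (sec F U)" if "openin X U" for U
    using sec_comm_binoid[OF that] by (rule comm_binoid.axioms)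
  have mon: "monoid (sec F U)" if "openin X U" for U
    using cm[OF that] by (rule comm_monoid.axioms)
  have hom: "res F U V (s \<otimes>\<^bsub>sec F U\<^esub> t) = res F U V s \<otimes>\<^bsub>sec F V\<^esub> res F U V t"
      "res F U V \<one>\<^bsub>sec F U\<^esub> = \<one>\<^bsub>sec F V\<^esub>"
    if "openin X U" "openin X V" "V \<subseteq> U" "s \<in> carrier (sec F U)" "t \<in> carrier (sec F U)" for U V s t
    using res_binoid_hom[OF that(1-3)] that(4,5) by (auto simp: binoid_hom_def hom_def)
  have UnitsI: "s \<in> Units (sec F U)"
    if "openin X U" "s \<in> carrier (sec F U)" "t \<in> carrier (sec F U)" "s \<otimes>\<^bsub>sec F U\<^esub> t = \<one>\<^bsub>sec F U\<^esub>" for U s t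
    using that comm_monoid.m_comm[OF cm[OF that(1)] that(2,3)] by (auto simp: Units_def)
  have Units: "s \<in> carrier (sec F U)" "inv\<^bsub>sec F U\<^esub> s \<in> carrier (sec F U)"
      "s \<otimes>\<^bsub>sec F U\<^esub> inv\<^bsub>sec F U\<^esub> s = \<one>\<^bsub>sec F U\<^esub>"
    if "openin X U" "s \<in> Units (sec F U)" for U s
    using that mon by (simp_all add: monoid.Units_r_inv monoid.Units_inv_closed monoid.Units_closed)
  have res_inv: "res F U V (inv\<^bsub>sec F U\<^esub> s) = inv\<^bsub>sec F V\<^esub> (res F U V s)"
      and res_Units: "res F U V s \<in> Units (sec F V)"
    if "openin X U" "openin X V" "V \<subseteq> U" "s \<in> Units (sec F U)" for U V s
  proof -
    note s = Units[OF that(1,4)]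
    have *: "res F U V s \<otimes>\<^bsub>sec F V\<^esub> res F U V (inv\<^bsub>sec F U\<^esub> s) = \<one>\<^bsub>sec F V\<^esub>"
      using hom[OF that(1-3) s(1,2)] s(3) by simp
    note c = res_closed[OF that(1-3) s(1)] res_closed[OF that(1-3) s(2)]
    show "res F U V s \<in> Units (sec F V)" by (rule UnitsI[OF that(2) c *])
    show "res F U V (inv\<^bsub>sec F U\<^esub> s) = inv\<^bsub>sec F V\<^esub> (res F U V s)"
      using monoid.inv_unique'[OF mon[OF that(2)] c *] * comm_monoid.m_comm[OF cm[OF that(2)] c] by simp
  qed
  show ?thesis
  proof (intro ab_sheaf.intro sheaf.intro presheaf.intro sheaf_axioms.intro ab_sheaf_axioms.intro)
    fix U V s
    assume "openin X U" "openin X V" "V \<subseteq> U" "s \<in> carrier (sec ?G U)"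
    then show "res ?G U V s \<in> carrier (sec ?G V)"
      using res_Units by (simp add: res car)
  next
    fix U s assume "openin X U" "s \<in> carrier (sec ?G U)"
    then show "res ?G U U s = s" by (simp add: res car res_id Units)
  next
    fix U V W s
    assume "openin X U" "openin X V" "openin X W" "W \<subseteq> V" "V \<subseteq> U" "s \<in> carrier (sec ?G U)"
    then show "res ?G V W (res ?G U V s) = res ?G U W s" by (simp add: res car res_comp Units)
  next
    fix \<V> s t
    assume V: "\<And>V. V \<in> \<V> \<Longrightarrow> openin X V" and st: "s \<in> carrier (sec ?G (\<Union>\<V>))" "t \<in> carrier (sec ?G (\<Union>\<V>))"
      and eq: "\<And>V. V \<in> \<V> \<Longrightarrow> res ?G (\<Union>\<V>) V s = res ?G (\<Union>\<V>) V t"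
    have "openin X (\<Union>\<V>)" using V by blast
    with st have "s \<in> carrier (sec F (\<Union>\<V>))" "t \<in> carrier (sec F (\<Union>\<V>))"
      using Units(1) by (simp_all add: car)
    then show "s = t" using locality[of \<V> s t] V eq[unfolded res] by blast
  next
    fix \<V> \<sigma>
    assume V: "\<And>V. V \<in> \<V> \<Longrightarrow> openin X V" and \<sigma>: "\<And>V. V \<in> \<V> \<Longrightarrow> \<sigma> V \<in> carrier (sec ?G V)"
      and compat: "\<And>V W. \<lbrakk>V \<in> \<V>; W \<in> \<V>\<rbrakk> \<Longrightarrow> res ?G V (V \<inter> W) (\<sigma> V) = res ?G W (V \<inter> W) (\<sigma> W)"
    have U: "openin X (\<Union>\<V>)" using V by blast
    note \<sigma>V = \<sigma>[unfolded car] Units[OF V \<sigma>[unfolded car]]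
    have VU: "V \<subseteq> \<Union>\<V>" if "V \<in> \<V>" for V using that by blast
    obtain t where t: "t \<in> carrier (sec F (\<Union>\<V>))" "\<forall>V\<in>\<V>. res F (\<Union>\<V>) V t = \<sigma> V"
      using gluing[of \<V> \<sigma>] V \<sigma>V(2) compat[unfolded res] by blast
    have "res F V (V \<inter> W) (inv\<^bsub>sec F V\<^esub> \<sigma> V) = res F W (V \<inter> W) (inv\<^bsub>sec F W\<^esub> \<sigma> W)"
      if "V \<in> \<V>" "W \<in> \<V>" for V W
      using res_inv[of V "V \<inter> W" "\<sigma> V"] res_inv[of W "V \<inter> W" "\<sigma> W"] V[OF that(1)] V[OF that(2)]
        \<sigma>V(1) that compat[OF that] by (simp add: res openin_Int)
    then obtain t' where t': "t' \<in> carrier (sec F (\<Union>\<V>))"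
        "\<forall>V\<in>\<V>. res F (\<Union>\<V>) V t' = inv\<^bsub>sec F V\<^esub> \<sigma> V"
      using gluing[of \<V> "\<lambda>V. inv\<^bsub>sec F V\<^esub> \<sigma> V"] V \<sigma>V(3) by blast
    have "t \<otimes>\<^bsub>sec F (\<Union>\<V>)\<^esub> t' = \<one>\<^bsub>sec F (\<Union>\<V>)\<^esub>"
    proof (rule locality[of \<V>])
      show "res F (\<Union>\<V>) V (t \<otimes>\<^bsub>sec F (\<Union>\<V>)\<^esub> t') = res F (\<Union>\<V>) V \<one>\<^bsub>sec F (\<Union>\<V>)\<^esub>" if "V \<in> \<V>" for V
        using hom[OF U V[OF that] VU[OF that] t(1) t'(1)] that t(2) t'(2) \<sigma>V(4) by simp
    qed (use V t(1) t'(1) mon[OF U] in \<open>auto simp: monoid.m_closed monoid.one_closed\<close>)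
    then have "t \<in> carrier (sec ?G (\<Union>\<V>))"
      using UnitsI[OF U t(1) t'(1)] by (simp add: car)
    then show "\<exists>t \<in> carrier (sec ?G (\<Union>\<V>)). \<forall>V\<in>\<V>. res ?G (\<Union>\<V>) V t = \<sigma> V"
      using t(2) by (auto simp: res)
  next
    fix U assume "openin X U"
    then show "comm_group (sec ?G U)" by (simp add: sec comm_monoid.units_comm_group cm)
  next
    fix U V assume "openin X U" "openin X V" "V \<subseteq> U"
    then show "res ?G U V \<in> hom (sec ?G U) (sec ?G V)"
      by (auto simp: hom_def res sec units_of_carrier units_of_mult res_Units intro!: hom(1) Units(1))
  qed
qed

text \<open>\<open>sum_group\<close> asks for finite support. For finite \<open>I\<close> the
  sections form the full product, so that gluing index by index stays inside the direct sum; for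
  infinite \<open>I\<close> a glued family could have infinite support.\<close>

lemma ab_sheaf_direct_sum:
  assumes fin: "finite I" and F: "\<And>i. i \<in> I \<Longrightarrow> ab_sheaf X (F i)"
  shows "ab_sheaf X (direct_sum I F)"
proof -
  let ?G = "direct_sum I F"
  have sec: "sec ?G U = sum_group I (\<lambda>i. sec (F i) U)"
    and res: "res ?G U V s = (\<lambda>i \<in> I. res (F i) U V (s i))" for U V s
    by (simp_all add: direct_sum_def)
  have cg: "comm_group (sec (F i) U)" if "i \<in> I" "openin X U" for i U
    using ab_sheaf.sec_comm_group[OF F] that by blast
  have grp: "group (sec (F i) U)" if "i \<in> I" "openin X U" for i U
    using cg[OF that] by (rule comm_group.axioms)
  have sh: "sheaf X (F i)" if "i \<in> I" for i using F[OF that] by (rule ab_sheaf.axioms)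
  have psh: "presheaf X (F i)" if "i \<in> I" for i using sh[OF that] by (rule sheaf.axioms)
  have car: "carrier (sec ?G U) = (\<Pi>\<^sub>E i\<in>I. carrier (sec (F i) U))" if "openin X U" for U
    using fin grp[OF _ that] by (simp add: sec carrier_sum_group)
  have closed: "res ?G U V s \<in> carrier (sec ?G V)"
    if "openin X U" "openin X V" "V \<subseteq> U" "s \<in> carrier (sec ?G U)" for U V s
    using that by (auto simp: car res intro!: presheaf.res_closed[OF psh])
  show ?thesis
  proof (intro ab_sheaf.intro sheaf.intro presheaf.intro sheaf_axioms.intro ab_sheaf_axioms.intro)
    fix U V s
    assume "openin X U" "openin X V" "V \<subseteq> U" "s \<in> carrier (sec ?G U)"
    then show "res ?G U V s \<in> carrier (sec ?G V)" by (rule closed)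
  next
    fix U s assume "openin X U" "s \<in> carrier (sec ?G U)"
    then show "res ?G U U s = s"
      by (intro extensionalityI[of _ I]) (auto simp: car res PiE_def intro!: presheaf.res_id[OF psh])
  next
    fix U V W s
    assume "openin X U" "openin X V" "openin X W" "W \<subseteq> V" "V \<subseteq> U" "s \<in> carrier (sec ?G U)"
    then show "res ?G V W (res ?G U V s) = res ?G U W s"
      by (auto simp: car res PiE_def intro!: restrict_ext presheaf.res_comp[OF psh])
  next
    fix \<V> s t
    assume V: "\<And>V. V \<in> \<V> \<Longrightarrow> openin X V" and st: "s \<in> carrier (sec ?G (\<Union>\<V>))" "t \<in> carrier (sec ?G (\<Union>\<V>))"
      and eq: "\<And>V. V \<in> \<V> \<Longrightarrow> res ?G (\<Union>\<V>) V s = res ?G (\<Union>\<V>) V t"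
    have U: "openin X (\<Union>\<V>)" using V by blast
    show "s = t"
    proof (rule PiE_ext[OF st[unfolded car[OF U]]])
      fix i assume i: "i \<in> I"
      show "s i = t i"
      proof (rule sheaf.locality[OF sh[OF i] V])
        show "res (F i) (\<Union>\<V>) V (s i) = res (F i) (\<Union>\<V>) V (t i)" if "V \<in> \<V>" for V
          using fun_cong[OF eq[OF that], of i] i by (simp add: res)
      qed (use st i in \<open>auto simp: car[OF U]\<close>)
    qed
  next
    fix \<V> \<sigma>
    assume V: "\<And>V. V \<in> \<V> \<Longrightarrow> openin X V" and \<sigma>: "\<And>V. V \<in> \<V> \<Longrightarrow> \<sigma> V \<in> carrier (sec ?G V)"
      and compat: "\<And>V W. \<lbrakk>V \<in> \<V>; W \<in> \<V>\<rbrakk> \<Longrightarrow> res ?G V (V \<inter> W) (\<sigma> V) = res ?G W (V \<inter> W) (\<sigma> W)"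
    have U: "openin X (\<Union>\<V>)" using V by blast
    have "\<exists>t \<in> carrier (sec (F i) (\<Union>\<V>)). \<forall>V\<in>\<V>. res (F i) (\<Union>\<V>) V t = \<sigma> V i" if i: "i \<in> I" for i
    proof (rule sheaf.gluing[OF sh[OF i] V])
      show "\<sigma> V i \<in> carrier (sec (F i) V)" if "V \<in> \<V>" for V
        using \<sigma>[OF that] i by (auto simp: car V[OF that])
      show "res (F i) V (V \<inter> W) (\<sigma> V i) = res (F i) W (V \<inter> W) (\<sigma> W i)" if "V \<in> \<V>" "W \<in> \<V>" for V W
        using fun_cong[OF compat[OF that], of i] i by (simp add: res)
    qed
    then obtain t where t: "\<And>i. i \<in> I \<Longrightarrow> t i \<in> carrier (sec (F i) (\<Union>\<V>))"
        "\<And>i V. \<lbrakk>i \<in> I; V \<in> \<V>\<rbrakk> \<Longrightarrow> res (F i) (\<Union>\<V>) V (t i) = \<sigma> V i"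
      by metis
    have "restrict t I \<in> carrier (sec ?G (\<Union>\<V>))" using t(1) by (auto simp: car[OF U])
    moreover have "res ?G (\<Union>\<V>) V (restrict t I) = \<sigma> V" if "V \<in> \<V>" for V
      using \<sigma>[OF that] t(2)[OF _ that]
      by (intro extensionalityI[of _ I]) (auto simp: car[OF V[OF that]] res PiE_def)
    ultimately show "\<exists>t \<in> carrier (sec ?G (\<Union>\<V>)). \<forall>V\<in>\<V>. res ?G (\<Union>\<V>) V t = \<sigma> V" by blast
  next
    fix U assume U: "openin X U"
    show "comm_group (sec ?G U)"
    proof (rule group.group_comm_groupI)
      show "group (sec ?G U)" unfolding sec by (rule sum_group) (rule grp[OF _ U])
      fix s t assume "s \<in> carrier (sec ?G U)" "t \<in> carrier (sec ?G U)"
      then have "s i \<in> carrier (sec (F i) U)" "t i \<in> carrier (sec (F i) U)" if "i \<in> I" for i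
        using that by (auto simp: car[OF U])
      then show "s \<otimes>\<^bsub>sec ?G U\<^esub> t = t \<otimes>\<^bsub>sec ?G U\<^esub> s"
        unfolding sec mult_sum_group by (intro restrict_ext comm_groupE(4)[OF cg[OF _ U]])
    qed
  next
    fix U V assume UV: "openin X U" "openin X V" "V \<subseteq> U"
    show "res ?G U V \<in> hom (sec ?G U) (sec ?G V)"
    proof (rule homI)
      fix s t assume st: "s \<in> carrier (sec ?G U)" "t \<in> carrier (sec ?G U)"
      show "res ?G U V (s \<otimes>\<^bsub>sec ?G U\<^esub> t) = res ?G U V s \<otimes>\<^bsub>sec ?G V\<^esub> res ?G U V t"
        unfolding res unfolding sec mult_sum_group
      proof (rule restrict_ext)
        fix i assume i: "i \<in> I"
        then have "s i \<in> carrier (sec (F i) U)" "t i \<in> carrier (sec (F i) U)"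
          using st by (auto simp: car[OF UV(1)])
        with i show "res (F i) U V ((\<lambda>i\<in>I. s i \<otimes>\<^bsub>sec (F i) U\<^esub> t i) i) =
            restrict (\<lambda>i. res (F i) U V (s i)) I i \<otimes>\<^bsub>sec (F i) V\<^esub> restrict (\<lambda>i. res (F i) U V (t i)) I i"
          using hom_mult[OF ab_sheaf.res_hom[OF F[OF i] UV]] by simp
      qed
    qed (rule closed[OF UV])
  qed
qed

section \<open>Sheafification of presheaves of abelian groups\<close>

context ab_presheaf
begin

section \<open>Germs and the group structure of the stalks\<close>

lemma sec_group: "openin X U \<Longrightarrow> group (sec F U)"
  using sec_comm_group by (rule comm_group.axioms)

lemma res_mult:
  assumes "openin X U" "openin X V" "V \<subseteq> U" "s \<in> carrier (sec F U)" "t \<in> carrier (sec F U)"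
  shows "res F U V (s \<otimes>\<^bsub>sec F U\<^esub> t) = res F U V s \<otimes>\<^bsub>sec F V\<^esub> res F U V t"
  using hom_mult[OF res_hom] assms by blast

lemma res_one:
  assumes "openin X U" "openin X V" "V \<subseteq> U"
  shows "res F U V \<one>\<^bsub>sec F U\<^esub> = \<one>\<^bsub>sec F V\<^esub>"
  using hom_one[OF res_hom] sec_group assms by blast

text \<open>\<open>germ\<close> collects the pairs that agree with \<open>(U, s)\<close> near
  \<open>p\<close>. It is an equivalence class because agreement is transitive: agreements on
  \<open>W\<close> and \<open>W'\<close> with a common middle section both restrict to
  \<open>W \<inter> W'\<close>.\<close>

lemma germ_eq_iff:
  assumes U: "openin X U" "p \<in> U" "s \<in> carrier (sec F U)"
    and V: "openin X V" "p \<in> V" "t \<in> carrier (sec F V)"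
  shows "germ X F p U s = germ X F p V t \<longleftrightarrow>
    (\<exists>W. openin X W \<and> p \<in> W \<and> W \<subseteq> U \<inter> V \<and> res F U W s = res F V W t)" (is "_ \<longleftrightarrow> ?R U s V t")
proof
  assume eq: "germ X F p U s = germ X F p V t"
  have "(V, t) \<in> germ X F p U s" unfolding eq using V by (auto simp: germ_def)
  then show "?R U s V t" by (auto simp: germ_def)
next
  have trans: "?R A a C c" if AB: "?R A a B b" and BC: "?R B b C c"
    and A: "openin X A" "a \<in> carrier (sec F A)" and B: "openin X B" "b \<in> carrier (sec F B)"
    and C: "openin X C" "c \<in> carrier (sec F C)" for A B C a b c
  proof -
    obtain W W' where W: "openin X W" "p \<in> W" "W \<subseteq> A \<inter> B" "res F A W a = res F B W b"
      and W': "openin X W'" "p \<in> W'" "W' \<subseteq> B \<inter> C" "res F B W' b = res F C W' c"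
      using AB BC by auto
    let ?W = "W \<inter> W'"
    have o: "openin X ?W" using W W' by auto
    have "res F A ?W a = res F W ?W (res F A W a)"
      using A W o by (intro res_comp[symmetric]) auto
    also have "\<dots> = res F B ?W b"
      unfolding W(4) using B W o by (intro res_comp) auto
    also have "\<dots> = res F W' ?W (res F B W' b)"
      using B W' o by (intro res_comp[symmetric]) auto
    also have "\<dots> = res F C ?W c"
      unfolding W'(4) using C W' o by (intro res_comp) auto
    finally have "res F A ?W a = res F C ?W c" .
    moreover have "p \<in> ?W" "?W \<subseteq> A \<inter> C" using W W' by auto
    ultimately show ?thesis using o by blast
  qed
  have sym: "?R B b A a" if "?R A a B b" for A B a b
    using that by (metis Int_commute)
  assume R: "?R U s V t"
  show "germ X F p U s = germ X F p V t"
  proof (rule Set.set_eqI)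
    fix P :: "'a set \<times> 'b"
    obtain C c where P: "P = (C, c)" by fastforce
    have "?R U s C c \<longleftrightarrow> ?R V t C c" if "openin X C" "c \<in> carrier (sec F C)"
    proof
      assume "?R U s C c"
      then show "?R V t C c" by (rule trans[OF sym[OF R] _ V(1,3) U(1,3) that])
    next
      assume "?R V t C c"
      then show "?R U s C c" by (rule trans[OF R _ U(1,3) V(1,3) that])
    qed
    then have "openin X C \<and> p \<in> C \<and> c \<in> carrier (sec F C) \<and> ?R U s C c \<longleftrightarrow>
        openin X C \<and> p \<in> C \<and> c \<in> carrier (sec F C) \<and> ?R V t C c"
      by blast
    then show "P \<in> germ X F p U s \<longleftrightarrow> P \<in> germ X F p V t"
      unfolding P germ_def mem_Collect_eq prod.case .
  qed
qed

lemma mem_germ: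
  assumes "openin X U" "p \<in> U" "s \<in> carrier (sec F U)"
  shows "(V, t) \<in> germ X F p U s \<longleftrightarrow>
    openin X V \<and> p \<in> V \<and> t \<in> carrier (sec F V) \<and> germ X F p V t = germ X F p U s"
proof -
  have "(V, t) \<in> germ X F p U s \<longleftrightarrow> openin X V \<and> p \<in> V \<and> t \<in> carrier (sec F V) \<and>
      (\<exists>W. openin X W \<and> p \<in> W \<and> W \<subseteq> U \<inter> V \<and> res F U W s = res F V W t)"
    by (simp only: germ_def mem_Collect_eq prod.case)
  also have "\<dots> \<longleftrightarrow> openin X V \<and> p \<in> V \<and> t \<in> carrier (sec F V) \<and> germ X F p U s = germ X F p V t"
    using germ_eq_iff[OF assms, of V t] by (intro conj_cong refl) simp
  finally show ?thesis by (simp only: eq_commute)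
qed

lemma germ_res:
  assumes "openin X U" "openin X V" "V \<subseteq> U" "p \<in> V" "s \<in> carrier (sec F U)"
  shows "germ X F p V (res F U V s) = germ X F p U s"
proof -
  have "p \<in> U" using assms by blast
  then show ?thesis
    using assms res_closed[OF assms(1-3,5)] res_id[OF assms(2)] by (subst germ_eq_iff) auto
qed

lemma carrier_stalk:
  "carrier (stalk X F p) = {germ X F p U s | U s. openin X U \<and> p \<in> U \<and> s \<in> carrier (sec F U)}"
  by (simp add: stalk_def)

text \<open>The product in \<open>stalk\<close> is a union over all pairs of representatives. It
  collapses to a single germ because all pairs give the same one.\<close>

lemma germ_mult:
  assumes U: "openin X U" "p \<in> U" "s \<in> carrier (sec F U)"
    and V: "openin X V" "p \<in> V" "t \<in> carrier (sec F V)"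
  shows "germ X F p U s \<otimes>\<^bsub>stalk X F p\<^esub> germ X F p V t =
    germ X F p (U \<inter> V) (res F U (U \<inter> V) s \<otimes>\<^bsub>sec F (U \<inter> V)\<^esub> res F V (U \<inter> V) t)"
    (is "_ = ?g U s V t")
proof -
  let ?A = "germ X F p U s" and ?B = "germ X F p V t"
  have eq: "?g U' s' V' t' = ?g U s V t" if "(U', s') \<in> ?A" "(V', t') \<in> ?B" for U' s' V' t'
  proof -
    have U': "openin X U'" "p \<in> U'" "s' \<in> carrier (sec F U')" "germ X F p U' s' = ?A"
      and V': "openin X V'" "p \<in> V'" "t' \<in> carrier (sec F V')" "germ X F p V' t' = ?B"
      using that mem_germ U V by auto
    obtain W1 where W1: "openin X W1" "p \<in> W1" "W1 \<subseteq> U' \<inter> U" "res F U' W1 s' = res F U W1 s"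
      using U'(4) germ_eq_iff[OF U'(1-3) U] by blast
    obtain W2 where W2: "openin X W2" "p \<in> W2" "W2 \<subseteq> V' \<inter> V" "res F V' W2 t' = res F V W2 t"
      using V'(4) germ_eq_iff[OF V'(1-3) V] by blast
    let ?W = "W1 \<inter> W2"
    have W: "openin X ?W" "p \<in> ?W" using W1 W2 by auto
    have sW: "res F U' ?W s' = res F U ?W s"
    proof -
      have "res F U' ?W s' = res F W1 ?W (res F U' W1 s')"
        using U' W1 W by (intro res_comp[symmetric]) auto
      also have "\<dots> = res F U ?W s"
        unfolding W1(4) using U W1 W by (intro res_comp) auto
      finally show ?thesis .
    qed
    have tW: "res F V' ?W t' = res F V ?W t"
    proof -
      have "res F V' ?W t' = res F W2 ?W (res F V' W2 t')"
        using V' W2 W by (intro res_comp[symmetric]) auto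
      also have "\<dots> = res F V ?W t"
        unfolding W2(4) using V W2 W by (intro res_comp) auto
      finally show ?thesis .
    qed
    \<comment> \<open>Both products are moved to \<open>?W\<close>, where the factors agree by
      \<open>sW\<close> and \<open>tW\<close>. The sets \<open>A\<close> and \<open>B\<close> stay
      general so that one argument serves both pairs of representatives.\<close>
    have *: "?g A a B b = germ X F p ?W (res F A ?W a \<otimes>\<^bsub>sec F ?W\<^esub> res F B ?W b)"
      if A: "openin X A" "a \<in> carrier (sec F A)" "W1 \<subseteq> A" and B: "openin X B" "b \<in> carrier (sec F B)" "W2 \<subseteq> B"
      for A B a b
    proof -
      have AB: "openin X (A \<inter> B)" "?W \<subseteq> A \<inter> B" using that by auto
      have c: "res F A (A \<inter> B) a \<in> carrier (sec F (A \<inter> B))" "res F B (A \<inter> B) b \<in> carrier (sec F (A \<inter> B))"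
        using that AB by (auto intro!: res_closed)
      have "?g A a B b = germ X F p ?W (res F (A \<inter> B) ?W
          (res F A (A \<inter> B) a \<otimes>\<^bsub>sec F (A \<inter> B)\<^esub> res F B (A \<inter> B) b))"
        using AB W c by (intro germ_res[symmetric] monoid.m_closed group.is_monoid sec_group)
      also have "res F (A \<inter> B) ?W (res F A (A \<inter> B) a \<otimes>\<^bsub>sec F (A \<inter> B)\<^esub> res F B (A \<inter> B) b) =
          res F (A \<inter> B) ?W (res F A (A \<inter> B) a) \<otimes>\<^bsub>sec F ?W\<^esub> res F (A \<inter> B) ?W (res F B (A \<inter> B) b)"
        by (rule res_mult[OF AB(1) W(1) AB(2) c])
      also have "res F (A \<inter> B) ?W (res F A (A \<inter> B) a) = res F A ?W a"
        using AB A W by (intro res_comp) auto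
      also have "res F (A \<inter> B) ?W (res F B (A \<inter> B) b) = res F B ?W b"
        using AB B W by (intro res_comp) auto
      finally show ?thesis .
    qed
    show ?thesis
      using *[of U' s' V' t'] *[of U s V t] U U' V V' W1(3) W2(3) sW tW by auto
  qed
  have ne: "?A \<noteq> {}" "?B \<noteq> {}" using mem_germ U V by blast+
  have "(\<Union>(U', s') \<in> ?A. \<Union>(V', t') \<in> ?B. ?g U' s' V' t') = (\<Union>P \<in> ?A. \<Union>Q \<in> ?B. ?g U s V t)"
    using eq[of "fst P" "snd P" "fst Q" "snd Q" for P Q] by (simp add: case_prod_beta cong: SUP_cong)
  also have "\<dots> = ?g U s V t" using ne by simp
  finally show ?thesis by (simp add: stalk_def)
qed

lemma germ_mult_same:
  assumes "openin X U" "p \<in> U" "s \<in> carrier (sec F U)" "t \<in> carrier (sec F U)"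
  shows "germ X F p U s \<otimes>\<^bsub>stalk X F p\<^esub> germ X F p U t = germ X F p U (s \<otimes>\<^bsub>sec F U\<^esub> t)"
  using germ_mult[OF assms(1-3,1,2,4)] assms by (simp add: res_id)

lemma germ_one:
  assumes "openin X U" "p \<in> U"
  shows "\<one>\<^bsub>stalk X F p\<^esub> = germ X F p U \<one>\<^bsub>sec F U\<^esub>"
proof -
  have "germ X F p U (res F (topspace X) U \<one>\<^bsub>sec F (topspace X)\<^esub>) =
      germ X F p (topspace X) \<one>\<^bsub>sec F (topspace X)\<^esub>"
    using assms openin_subset[OF assms(1)]
    by (intro germ_res) (auto intro!: monoid.one_closed group.is_monoid sec_group)
  then show ?thesis
    using assms openin_subset[OF assms(1)] by (simp add: stalk_def res_one)
qed

lemma common_nbhd: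
  assumes "A \<in> carrier (stalk X F p)" "B \<in> carrier (stalk X F p)"
  obtains W a b where "openin X W" "p \<in> W" "a \<in> carrier (sec F W)" "b \<in> carrier (sec F W)"
    "A = germ X F p W a" "B = germ X F p W b"
proof -
  from assms obtain U s V t where U: "openin X U" "p \<in> U" "s \<in> carrier (sec F U)" "A = germ X F p U s"
    and V: "openin X V" "p \<in> V" "t \<in> carrier (sec F V)" "B = germ X F p V t"
    unfolding carrier_stalk by blast
  have W: "openin X (U \<inter> V)" "p \<in> U \<inter> V" using U V by auto
  show ?thesis
  proof (rule that[OF W])
    show "res F U (U \<inter> V) s \<in> carrier (sec F (U \<inter> V))" "res F V (U \<inter> V) t \<in> carrier (sec F (U \<inter> V))"
      using U V W by (auto intro!: res_closed)
    show "A = germ X F p (U \<inter> V) (res F U (U \<inter> V) s)" "B = germ X F p (U \<inter> V) (res F V (U \<inter> V) t)"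
      using U V W by (simp_all add: germ_res)
  qed
qed

lemma stalk_comm_group:
  assumes p: "p \<in> topspace X"
  shows "comm_group (stalk X F p)"
proof (rule comm_groupI)
  let ?S = "stalk X F p"
  have m: "a \<otimes>\<^bsub>sec F U\<^esub> b \<in> carrier (sec F U)"
    if "openin X U" "a \<in> carrier (sec F U)" "b \<in> carrier (sec F U)" for U a b
    using that by (simp add: monoid.m_closed group.is_monoid sec_group)
  have g: "germ X F p U a \<in> carrier ?S" if "openin X U" "p \<in> U" "a \<in> carrier (sec F U)" for U a
    using that by (auto simp: carrier_stalk)
  fix A B assume AB: "A \<in> carrier ?S" "B \<in> carrier ?S"
  obtain W a b where W: "openin X W" "p \<in> W" "a \<in> carrier (sec F W)" "b \<in> carrier (sec F W)"
    "A = germ X F p W a" "B = germ X F p W b" using common_nbhd[OF AB] .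
  interpret W: comm_group "sec F W" by (rule sec_comm_group[OF W(1)])
  show "A \<otimes>\<^bsub>?S\<^esub> B \<in> carrier ?S"
    using W by (simp add: germ_mult_same g m)
  show "A \<otimes>\<^bsub>?S\<^esub> B = B \<otimes>\<^bsub>?S\<^esub> A"
    using W by (simp add: germ_mult_same W.m_comm)
  fix C assume C: "C \<in> carrier ?S"
  \<comment> \<open>This supplies a representative \<open>c\<close> of \<open>C\<close>. Over the
    intersection with \<open>W\<close> all three germs are represented at once, and associativity is
    inherited from the sections there.\<close>
  obtain V ab c where V: "openin X V" "p \<in> V" "ab \<in> carrier (sec F V)" "c \<in> carrier (sec F V)"
    "A \<otimes>\<^bsub>?S\<^esub> B = germ X F p V ab" "C = germ X F p V c" using common_nbhd[OF \<open>A \<otimes>\<^bsub>?S\<^esub> B \<in> carrier ?S\<close> C] .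
  let ?U = "W \<inter> V"
  have U: "openin X ?U" "p \<in> ?U" using W V by auto
  interpret U: comm_group "sec F ?U" by (rule sec_comm_group[OF U(1)])
  have "A = germ X F p ?U (res F W ?U a)" "B = germ X F p ?U (res F W ?U b)" "C = germ X F p ?U (res F V ?U c)"
    using W V U by (simp_all add: germ_res)
  moreover have "res F W ?U a \<in> carrier (sec F ?U)" "res F W ?U b \<in> carrier (sec F ?U)"
      "res F V ?U c \<in> carrier (sec F ?U)"
    using W V U by (auto intro!: res_closed)
  ultimately show "A \<otimes>\<^bsub>?S\<^esub> B \<otimes>\<^bsub>?S\<^esub> C = A \<otimes>\<^bsub>?S\<^esub> (B \<otimes>\<^bsub>?S\<^esub> C)"
    using U by (simp add: germ_mult_same U.m_assoc)
next
  let ?S = "stalk X F p"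
  have one: "\<one>\<^bsub>?S\<^esub> = germ X F p (topspace X) \<one>\<^bsub>sec F (topspace X)\<^esub>" by (simp add: stalk_def)
  show "\<one>\<^bsub>?S\<^esub> \<in> carrier ?S"
    using p unfolding one by (force simp: carrier_stalk intro!: monoid.one_closed group.is_monoid sec_group)
  fix A assume A: "A \<in> carrier ?S"
  then obtain W a where W: "openin X W" "p \<in> W" "a \<in> carrier (sec F W)" "A = germ X F p W a"
    unfolding carrier_stalk by blast
  interpret W: comm_group "sec F W" by (rule sec_comm_group[OF W(1)])
  show "\<one>\<^bsub>?S\<^esub> \<otimes>\<^bsub>?S\<^esub> A = A"
    using W by (simp add: germ_one germ_mult_same)
  have "germ X F p W (inv\<^bsub>sec F W\<^esub> a) \<in> carrier ?S"
    using W by (force simp: carrier_stalk)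
  moreover have "germ X F p W (inv\<^bsub>sec F W\<^esub> a) \<otimes>\<^bsub>?S\<^esub> A = \<one>\<^bsub>?S\<^esub>"
    using W by (simp add: germ_one germ_mult_same)
  ultimately show "\<exists>B \<in> carrier ?S. B \<otimes>\<^bsub>?S\<^esub> A = \<one>\<^bsub>?S\<^esub>" by blast
qed

section \<open>Sections of the sheafification\<close>

lemma carrier_sheafification:
  "\<sigma> \<in> carrier (sec (sheafification X F) U) \<longleftrightarrow> \<sigma> \<in> extensional U \<and>
    (\<forall>p \<in> U. \<exists>V. openin X V \<and> p \<in> V \<and> V \<subseteq> U \<and>
       (\<exists>t \<in> carrier (sec F V). \<forall>q \<in> V. \<sigma> q = germ X F q V t))"
proof -
  have "\<sigma> p \<in> carrier (stalk X F p)"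
    if "openin X V" "p \<in> V" "t \<in> carrier (sec F V)" "\<forall>q \<in> V. \<sigma> q = germ X F q V t" for V p t
    using that by (auto simp: carrier_stalk)
  then show ?thesis
    by (auto simp: sheafification_def PiE_def Pi_def)
qed

lemma sheafification_value:
  "\<sigma> \<in> carrier (sec (sheafification X F) U) \<Longrightarrow> p \<in> U \<Longrightarrow> \<sigma> p \<in> carrier (stalk X F p)"
  by (auto simp: sheafification_def)

lemma sheafification_simps:
  "\<sigma> \<otimes>\<^bsub>sec (sheafification X F) U\<^esub> \<tau> = (\<lambda>p \<in> U. \<sigma> p \<otimes>\<^bsub>stalk X F p\<^esub> \<tau> p)"
  "\<one>\<^bsub>sec (sheafification X F) U\<^esub> = (\<lambda>p \<in> U. \<one>\<^bsub>stalk X F p\<^esub>)"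
  "res (sheafification X F) U V \<sigma> = restrict \<sigma> V"
  by (simp_all add: sheafification_def)

lemma sheafification_mult_closed:
  assumes st: "\<sigma> \<in> carrier (sec (sheafification X F) U)" "\<tau> \<in> carrier (sec (sheafification X F) U)"
  shows "\<sigma> \<otimes>\<^bsub>sec (sheafification X F) U\<^esub> \<tau> \<in> carrier (sec (sheafification X F) U)"
  unfolding carrier_sheafification
proof (intro conjI ballI)
  fix p assume p: "p \<in> U"
  obtain V s where V: "openin X V" "p \<in> V" "V \<subseteq> U" "s \<in> carrier (sec F V)" "\<forall>q\<in>V. \<sigma> q = germ X F q V s"
    using st(1) p unfolding carrier_sheafification by blast
  obtain W t where W: "openin X W" "p \<in> W" "W \<subseteq> U" "t \<in> carrier (sec F W)" "\<forall>q\<in>W. \<tau> q = germ X F q W t"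
    using st(2) p unfolding carrier_sheafification by blast
  let ?r = "res F V (V \<inter> W) s \<otimes>\<^bsub>sec F (V \<inter> W)\<^esub> res F W (V \<inter> W) t"
  have VW: "openin X (V \<inter> W)" "p \<in> V \<inter> W" "V \<inter> W \<subseteq> U" using V W by auto
  moreover have "?r \<in> carrier (sec F (V \<inter> W))"
    using V W VW by (auto intro!: monoid.m_closed group.is_monoid sec_group res_closed)
  moreover have "\<forall>q \<in> V \<inter> W. (\<sigma> \<otimes>\<^bsub>sec (sheafification X F) U\<^esub> \<tau>) q = germ X F q (V \<inter> W) ?r"
    using V W by (auto simp: sheafification_simps germ_mult)
  ultimately show "\<exists>V. openin X V \<and> p \<in> V \<and> V \<subseteq> U \<and> (\<exists>t \<in> carrier (sec F V).
      \<forall>q \<in> V. (\<sigma> \<otimes>\<^bsub>sec (sheafification X F) U\<^esub> \<tau>) q = germ X F q V t)" by blast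
qed (simp add: sheafification_simps)

lemma sheafification_restrict_closed:
  assumes V: "openin X V" "V \<subseteq> U" and s: "\<sigma> \<in> carrier (sec (sheafification X F) U)"
  shows "restrict \<sigma> V \<in> carrier (sec (sheafification X F) V)"
  unfolding carrier_sheafification
proof (intro conjI ballI)
  fix p assume p: "p \<in> V"
  then obtain W t where W: "openin X W" "p \<in> W" "W \<subseteq> U" "t \<in> carrier (sec F W)" "\<forall>q\<in>W. \<sigma> q = germ X F q W t"
    using s V unfolding carrier_sheafification by blast
  have VW: "openin X (V \<inter> W)" "p \<in> V \<inter> W" "V \<inter> W \<subseteq> V" using V W p by auto
  moreover have "res F W (V \<inter> W) t \<in> carrier (sec F (V \<inter> W))"
    using W VW by (auto intro!: res_closed)
  moreover have "\<forall>q \<in> V \<inter> W. restrict \<sigma> V q = germ X F q (V \<inter> W) (res F W (V \<inter> W) t)"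
    using W VW by (auto simp: germ_res)
  ultimately show "\<exists>W. openin X W \<and> p \<in> W \<and> W \<subseteq> V \<and> (\<exists>t \<in> carrier (sec F W).
      \<forall>q \<in> W. restrict \<sigma> V q = germ X F q W t)" by blast
qed simp

lemma sheafification_comm_group:
  assumes U: "openin X U"
  shows "comm_group (sec (sheafification X F) U)"
proof (rule comm_groupI)
  let ?G = "sec (sheafification X F) U"
  have cg: "comm_group (stalk X F p)" if "p \<in> U" for p
    using stalk_comm_group openin_subset[OF U] that by blast
  show "\<sigma> \<otimes>\<^bsub>?G\<^esub> \<tau> \<in> carrier ?G" if "\<sigma> \<in> carrier ?G" "\<tau> \<in> carrier ?G" for \<sigma> \<tau>
    by (rule sheafification_mult_closed[OF that])
  show "\<sigma> \<otimes>\<^bsub>?G\<^esub> \<tau> \<otimes>\<^bsub>?G\<^esub> \<rho> = \<sigma> \<otimes>\<^bsub>?G\<^esub> (\<tau> \<otimes>\<^bsub>?G\<^esub> \<rho>)"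
    if "\<sigma> \<in> carrier ?G" "\<tau> \<in> carrier ?G" "\<rho> \<in> carrier ?G" for \<sigma> \<tau> \<rho>
    unfolding sheafification_simps
    using that[THEN sheafification_value] by (intro restrict_ext) (simp add: comm_groupE(3)[OF cg])
  show "\<sigma> \<otimes>\<^bsub>?G\<^esub> \<tau> = \<tau> \<otimes>\<^bsub>?G\<^esub> \<sigma>" if "\<sigma> \<in> carrier ?G" "\<tau> \<in> carrier ?G" for \<sigma> \<tau>
    unfolding sheafification_simps
    using that[THEN sheafification_value] by (intro restrict_ext) (simp add: comm_groupE(4)[OF cg])
  have "\<one>\<^bsub>sec F U\<^esub> \<in> carrier (sec F U)"
    using sec_group[OF U] by (simp add: monoid.one_closed group.is_monoid)
  then show "\<one>\<^bsub>?G\<^esub> \<in> carrier ?G"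
    using U unfolding carrier_sheafification
    by (auto simp: sheafification_simps germ_one intro!: exI[of _ U])
  fix \<sigma> assume s: "\<sigma> \<in> carrier ?G"
  have ext: "\<sigma> \<in> extensional U" using s by (simp add: carrier_sheafification)
  show "\<one>\<^bsub>?G\<^esub> \<otimes>\<^bsub>?G\<^esub> \<sigma> = \<sigma>"
    using sheafification_value[OF s] comm_groupE(5)[OF cg]
    by (intro extensionalityI[OF _ ext]) (simp_all add: sheafification_simps)
  let ?i = "\<lambda>p \<in> U. inv\<^bsub>stalk X F p\<^esub> \<sigma> p"
  have "?i \<in> carrier ?G"
    unfolding carrier_sheafification
  proof (intro conjI ballI)
    fix p assume p: "p \<in> U"
    obtain V t where V: "openin X V" "p \<in> V" "V \<subseteq> U" "t \<in> carrier (sec F V)" "\<forall>q\<in>V. \<sigma> q = germ X F q V t"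
      using s p unfolding carrier_sheafification by blast
    interpret V: group "sec F V" by (rule sec_group[OF V(1)])
    \<comment> \<open>The pointwise inverse is again locally a section: where
      \<open>\<sigma>\<close> is the germ of \<open>t\<close>, it is the germ of the inverse of
      \<open>t\<close>.\<close>
    have "?i q = germ X F q V (inv\<^bsub>sec F V\<^esub> t)" if q: "q \<in> V" for q
    proof -
      have qU: "q \<in> U" using q V by blast
      have "inv\<^bsub>stalk X F q\<^esub> (germ X F q V t) = germ X F q V (inv\<^bsub>sec F V\<^esub> t)"
        using V q by (intro group.inv_equality comm_group.axioms(2)[OF cg[OF qU]])
          (force simp: germ_mult_same germ_one carrier_stalk)+
      with V q qU show ?thesis by simp
    qed
    with V show "\<exists>V. openin X V \<and> p \<in> V \<and> V \<subseteq> U \<and>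
        (\<exists>t \<in> carrier (sec F V). \<forall>q \<in> V. ?i q = germ X F q V t)" by (meson V.inv_closed)
  qed simp
  moreover have "?i \<otimes>\<^bsub>?G\<^esub> \<sigma> = \<one>\<^bsub>?G\<^esub>"
    unfolding sheafification_simps
    using sheafification_value[OF s] by (intro restrict_ext) (simp add: group.l_inv comm_group.axioms(2)[OF cg])
  ultimately show "\<exists>\<tau> \<in> carrier ?G. \<tau> \<otimes>\<^bsub>?G\<^esub> \<sigma> = \<one>\<^bsub>?G\<^esub>" by blast
qed

text \<open>Restriction is restriction of functions and membership is a local condition, so
  compatible sections glue to a function that satisfies it again; no gluing inside \<open>F\<close>
  takes place.\<close>

lemma ab_sheaf_sheafification: "ab_sheaf X (sheafification X F)"
proof -
  let ?G = "sheafification X F"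
  have ext: "s \<in> extensional U" if "s \<in> carrier (sec ?G U)" for s U
    using that by (simp add: carrier_sheafification)
  show ?thesis
  proof (intro ab_sheaf.intro sheaf.intro presheaf.intro sheaf_axioms.intro ab_sheaf_axioms.intro)
    fix U V s
    assume "openin X U" "openin X V" "V \<subseteq> U" "s \<in> carrier (sec ?G U)"
    then show "res ?G U V s \<in> carrier (sec ?G V)"
      by (simp add: sheafification_simps sheafification_restrict_closed)
  next
    fix U s assume "s \<in> carrier (sec ?G U)"
    then show "res ?G U U s = s"
      using ext by (simp add: sheafification_simps extensional_restrict)
  next
    fix U V W :: "'a set" and s assume "W \<subseteq> V"
    then show "res ?G V W (res ?G U V s) = res ?G U W s"
      by (simp add: sheafification_simps Int_absorb1)
  next
    fix \<V> s t
    assume st: "s \<in> carrier (sec ?G (\<Union>\<V>))" "t \<in> carrier (sec ?G (\<Union>\<V>))"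
      and eq: "\<And>V. V \<in> \<V> \<Longrightarrow> res ?G (\<Union>\<V>) V s = res ?G (\<Union>\<V>) V t"
    show "s = t"
    proof (rule extensionalityI[OF ext[OF st(1)] ext[OF st(2)]])
      fix p assume "p \<in> \<Union>\<V>"
      then obtain V where V: "V \<in> \<V>" "p \<in> V" by blast
      from fun_cong[OF eq[OF V(1)], of p] V show "s p = t p"
        by (simp add: sheafification_simps)
    qed
  next
    fix \<V> \<sigma>
    assume V: "\<And>V. V \<in> \<V> \<Longrightarrow> openin X V" and \<sigma>: "\<And>V. V \<in> \<V> \<Longrightarrow> \<sigma> V \<in> carrier (sec ?G V)"
      and compat: "\<And>V W. \<lbrakk>V \<in> \<V>; W \<in> \<V>\<rbrakk> \<Longrightarrow> res ?G V (V \<inter> W) (\<sigma> V) = res ?G W (V \<inter> W) (\<sigma> W)"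
    \<comment> \<open>Some member of the cover is chosen at each point; by \<open>compat\<close> the
      value does not depend on the choice.\<close>
    define t where "t = (\<lambda>p \<in> \<Union>\<V>. \<sigma> (SOME V. V \<in> \<V> \<and> p \<in> V) p)"
    have t: "t p = \<sigma> V p" if "V \<in> \<V>" "p \<in> V" for p V
    proof -
      let ?W = "SOME V. V \<in> \<V> \<and> p \<in> V"
      have W: "?W \<in> \<V> \<and> p \<in> ?W" by (rule someI[of _ V]) (use that in auto)
      from fun_cong[OF compat[OF that(1) W[THEN conjunct1]], of p] W that
      have "\<sigma> ?W p = \<sigma> V p" by (simp add: sheafification_simps)
      moreover have "p \<in> \<Union>\<V>" using that by blast
      ultimately show ?thesis by (simp add: t_def)
    qed
    have "t \<in> carrier (sec ?G (\<Union>\<V>))"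
      unfolding carrier_sheafification
    proof (intro conjI ballI)
      fix p assume "p \<in> \<Union>\<V>"
      then obtain V where V: "V \<in> \<V>" "p \<in> V" by blast
      obtain W r where W: "openin X W" "p \<in> W" "W \<subseteq> V" "r \<in> carrier (sec F W)"
          "\<forall>q \<in> W. \<sigma> V q = germ X F q W r"
        using \<sigma>[OF V(1)] V(2) unfolding carrier_sheafification by blast
      moreover have "W \<subseteq> \<Union>\<V>" using V(1) W(3) by blast
      moreover have "\<forall>q \<in> W. t q = germ X F q W r"
        using t[OF V(1)] W(3,5) by (metis subsetD)
      ultimately show "\<exists>W. openin X W \<and> p \<in> W \<and> W \<subseteq> \<Union>\<V> \<and>
          (\<exists>r \<in> carrier (sec F W). \<forall>q \<in> W. t q = germ X F q W r)" by metis
    qed (simp add: t_def)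
    moreover have "res ?G (\<Union>\<V>) V t = \<sigma> V" if "V \<in> \<V>" for V
      unfolding sheafification_simps
      using t[OF that] by (intro extensionalityI[OF _ ext[OF \<sigma>[OF that]]]) simp_all
    ultimately show "\<exists>t \<in> carrier (sec ?G (\<Union>\<V>)). \<forall>V \<in> \<V>. res ?G (\<Union>\<V>) V t = \<sigma> V" by blast
  next
    fix U assume "openin X U"
    then show "comm_group (sec ?G U)" by (rule sheafification_comm_group)
  next
    fix U V assume UV: "openin X U" "openin X V" "V \<subseteq> U"
    then show "res ?G U V \<in> hom (sec ?G U) (sec ?G V)"
      by (intro homI) (auto simp: sheafification_simps sheafification_restrict_closed fun_eq_iff)
  qed
qed

end

section \<open>Monomials\<close>

lemma (in comm_monoid) finprod_in_submonoid:
  assumes S: "submonoid S G" and fin: "finite J" and f: "\<And>j. j \<in> J \<Longrightarrow> f j \<in> S"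
  shows "finprod G f J \<in> S"
  using fin f
proof (induction J rule: finite_induct)
  case empty
  then show ?case by (simp add: submonoid.one_closed[OF S])
next
  case (insert j J)
  have c: "f i \<in> carrier G" if "i \<in> insert j J" for i
    using submonoid.subset[OF S] insert.prems[OF that] by blast
  have "finprod G f (insert j J) = f j \<otimes> finprod G f J"
    by (rule finprod_insert[OF insert.hyps]) (use c in \<open>auto simp only: Pi_iff insert_iff\<close>)
  then show ?case using insert.IH insert.prems submonoid.m_closed[OF S] by simp
qed

locale semifree_binoid = comm_binoid M for M :: "('a, 'm) binoid_scheme" (structure) +
  fixes I :: "'i set" and x :: "'i \<Rightarrow> 'a"
  assumes finite_I [simp]: "finite I" and semifree: "semifree M I x"
begin

text \<open>The product runs over all of \<open>I\<close>, not over the support as in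
  \<open>semifree\<close>, so that exponents add without any tracking of supports;
  \<open>monomial_support\<close> reconciles the two forms.\<close>

definition monomial :: "('i \<Rightarrow> nat) \<Rightarrow> 'a" where
  "monomial e = finprod M (\<lambda>i. x i [^] e i) I"

lemma x_closed [simp]: "i \<in> I \<Longrightarrow> x i \<in> carrier M"
  using semifree by (auto simp: semifree_def)

lemma monomial_closed [simp]: "monomial e \<in> carrier M"
  by (simp add: monomial_def Pi_def)

lemma monomial_cong: "(\<And>i. i \<in> I \<Longrightarrow> e i = f i) \<Longrightarrow> monomial e = monomial f"
  unfolding monomial_def by (rule finprod_cong') auto

lemma monomial_mult: "monomial e \<otimes> monomial f = monomial (\<lambda>i. e i + f i)"
proof -
  have "monomial (\<lambda>i. e i + f i) = finprod M (\<lambda>i. x i [^] e i \<otimes> x i [^] f i) I"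
    unfolding monomial_def by (rule finprod_cong') (auto simp: nat_pow_mult)
  then show ?thesis by (simp add: monomial_def Pi_def)
qed

lemma monomial_zero [simp]: "monomial (\<lambda>_. 0) = \<one>"
  by (simp add: monomial_def)

lemma monomial_support: "monomial e = finprod M (\<lambda>i. x i [^] e i) {i \<in> I. e i \<noteq> 0}"
  unfolding monomial_def by (rule finprod_mono_neutral_cong_right) auto

text \<open>The value \<open>infty M\<close> has to be excluded: if a product of two generators
  equals it, so do all multiples of that product. Uniqueness in \<open>semifree\<close> concerns
  extensional vectors, hence the passage to \<open>restrict e I\<close>.\<close>

lemma exponent_unique:
  assumes "monomial e \<noteq> infty M" "monomial e = monomial f" "i \<in> I"
  shows "e i = f i"
proof -
  have *: "restrict g I \<in> (I \<rightarrow>\<^sub>E UNIV) \<and> finite {i \<in> I. restrict g I i \<noteq> 0} \<and>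
      monomial g = finprod M (\<lambda>i. x i [^] restrict g I i) {i \<in> I. restrict g I i \<noteq> 0}" for g :: "'i \<Rightarrow> nat"
    using monomial_support[of "restrict g I"] monomial_cong[of g "restrict g I"] by simp
  let ?P = "\<lambda>n :: 'i \<Rightarrow> nat. n \<in> (I \<rightarrow>\<^sub>E UNIV) \<and> finite {i \<in> I. n i \<noteq> 0} \<and>
      monomial e = finprod M (\<lambda>i. x i [^] n i) {i \<in> I. n i \<noteq> 0}"
  have "\<exists>!n. ?P n"
    using semifree assms(1) unfolding semifree_def by simp
  then obtain n where n: "\<And>m. ?P m \<Longrightarrow> m = n" by (elim ex1E) blast
  have "restrict e I = restrict f I"
    using n[OF *[of e]] n[OF *[of f, folded assms(2)]] by simp
  then have "restrict e I i = restrict f I i" by simp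
  with assms(3) show ?thesis by simp
qed

lemma ex_monomial:
  assumes "a \<in> carrier M" "a \<noteq> infty M"
  obtains e where "a = monomial e"
proof -
  obtain n :: "'i \<Rightarrow> nat" where "a = finprod M (\<lambda>i. x i [^] n i) {i \<in> I. n i \<noteq> 0}"
    using semifree assms unfolding semifree_def by blast
  then show thesis using that monomial_support by metis
qed

text \<open>The complement of a prime is a submonoid that contains all divisors of its elements.
  Closure under divisors, applied to a factor \<open>x i\<close> split off from the monomial, gives
  one direction; closure under products gives the other.\<close>

lemma monomial_notin_prime_iff:
  assumes p: "p \<in> prime_ideals M"
  shows "monomial e \<notin> p \<longleftrightarrow> (\<forall>i \<in> I. e i \<noteq> 0 \<longrightarrow> x i \<notin> p)"
proof
  assume e: "monomial e \<notin> p"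
  show "\<forall>i \<in> I. e i \<noteq> 0 \<longrightarrow> x i \<notin> p"
  proof (intro ballI impI)
    fix i assume i: "i \<in> I" "e i \<noteq> 0"
    let ?r = "finprod M (\<lambda>i. x i [^] e i) (I - {i})"
    have r: "?r \<in> carrier M" by (intro finprod_closed) auto
    have "monomial e = finprod M (\<lambda>i. x i [^] e i) (insert i (I - {i}))"
      using i by (simp add: monomial_def insert_absorb)
    also have "\<dots> = x i [^] e i \<otimes> ?r"
      using i by (intro finprod_insert) auto
    also have "x i [^] e i = x i \<otimes> x i [^] (e i - 1)"
      using i nat_pow_Suc2[of "x i" "e i - 1"] by simp
    finally have "monomial e = x i \<otimes> (x i [^] (e i - 1) \<otimes> ?r)"
      using i r by (simp add: m_assoc)
    then show "x i \<notin> p"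
      using e i r not_in_prime_dvd(1)[OF p, of "x i" "x i [^] (e i - 1) \<otimes> ?r"] by simp
  qed
next
  assume e: "\<forall>i \<in> I. e i \<noteq> 0 \<longrightarrow> x i \<notin> p"
  interpret S: submonoid "carrier M - p" M by (rule submonoid_compl_prime[OF p])
  have pow: "x i [^] k \<in> carrier M - p" if "x i \<in> carrier M - p" for i and k :: nat
  proof (induction k)
    case (Suc k)
    then show ?case using S.m_closed[OF Suc that] by simp
  qed (use S.one_closed in simp)
  have mem: "x i [^] e i \<in> carrier M - p" if "i \<in> I" for i
  proof (cases "e i = 0")
    case False
    then show ?thesis using pow e that by simp
  qed (use S.one_closed in simp)
  have "monomial e \<in> carrier M - p"
    unfolding monomial_def by (rule finprod_in_submonoid[OF submonoid_compl_prime[OF p] finite_I mem])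
  then show "monomial e \<notin> p" by blast
qed

section \<open>Laurent monomials in the local binoids\<close>

text \<open>The denominator of \<open>laurent p k\<close> is a legitimate one only if \<open>supported_off p k\<close>.\<close>

definition laurent :: "'a set \<Rightarrow> ('i \<Rightarrow> int) \<Rightarrow> ('a \<times> 'a) set" where
  "laurent p k = fraction M (carrier M - p) (monomial (\<lambda>i. nat (k i))) (monomial (\<lambda>i. nat (- k i)))"

text \<open>On \<open>I\<close> these vectors form the free abelian group on the generators outside
  \<open>p\<close>. A predicate in \<open>p\<close> lets the same \<open>k\<close> be used at all
  primes of a neighbourhood.\<close>

definition supported_off :: "'a set \<Rightarrow> ('i \<Rightarrow> int) \<Rightarrow> bool" where
  "supported_off p k \<longleftrightarrow> (\<forall>i \<in> I. k i \<noteq> 0 \<longrightarrow> x i \<notin> p)"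

lemma laurent_cong:
  assumes "\<And>i. i \<in> I \<Longrightarrow> k i = l i"
  shows "laurent p k = laurent p l"
  using assms monomial_cong[of "\<lambda>i. nat (k i)" "\<lambda>i. nat (l i)"]
    monomial_cong[of "\<lambda>i. nat (- k i)" "\<lambda>i. nat (- l i)"] by (simp add: laurent_def)

lemma monomial_off:
  assumes "p \<in> prime_ideals M" "supported_off p k"
  shows "monomial (\<lambda>i. nat (k i)) \<in> carrier M - p" "monomial (\<lambda>i. nat (- k i)) \<in> carrier M - p"
  using assms by (auto simp: monomial_notin_prime_iff supported_off_def)

text \<open>With k+ and k- for the positive and negative part of \<open>k\<close>, the equation e +
  k- = k+ + f holds on \<open>I\<close>. The cross products therefore agree outright, and nothing
  has to be cancelled in \<open>M\<close>.\<close>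

lemma laurent_eqI:
  assumes p: "p \<in> prime_ideals M" and k: "supported_off p k" and f: "monomial f \<notin> p"
    and eq: "\<And>i. i \<in> I \<Longrightarrow> k i = int (e i) - int (f i)"
  shows "fraction M (carrier M - p) (monomial e) (monomial f) = laurent p k"
  unfolding laurent_def
proof (rule fraction_eqI[OF submonoid_compl_prime[OF p]])
  show "monomial e \<otimes> monomial (\<lambda>i. nat (- k i)) = monomial (\<lambda>i. nat (k i)) \<otimes> monomial f"
    unfolding monomial_mult by (rule monomial_cong) (simp add: eq)
qed (use f monomial_off[OF p k] in auto)

text \<open>The product has exponents k+ + l+ over k- + l-, in general not the positive and negative
  parts of the sum; \<open>laurent_eqI\<close> absorbs the common factors.\<close>

lemma laurent_mult:
  assumes p: "p \<in> prime_ideals M" and k: "supported_off p k" and l: "supported_off p l"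
  shows "laurent p k \<otimes>\<^bsub>local_binoid M p\<^esub> laurent p l = laurent p (\<lambda>i. k i + l i)"
proof -
  have m: "monomial (\<lambda>i. nat (- k i)) \<in> carrier M - p" "monomial (\<lambda>i. nat (- l i)) \<in> carrier M - p"
    using monomial_off p k l by blast+
  have "laurent p k \<otimes>\<^bsub>local_binoid M p\<^esub> laurent p l =
      fraction M (carrier M - p) (monomial (\<lambda>i. nat (k i) + nat (l i))) (monomial (\<lambda>i. nat (- k i) + nat (- l i)))"
    unfolding laurent_def
    using m by (simp only: mult_fraction[OF submonoid_compl_prime[OF p]] monomial_closed monomial_mult)
  also have "\<dots> = laurent p (\<lambda>i. k i + l i)"
  proof (rule laurent_eqI[OF p])
    show "supported_off p (\<lambda>i. k i + l i)" "monomial (\<lambda>i. nat (- k i) + nat (- l i)) \<notin> p"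
      using k l by (auto simp: supported_off_def monomial_notin_prime_iff[OF p])
  qed simp
  finally show ?thesis .
qed

lemma laurent_zero: "laurent p (\<lambda>_. 0) = \<one>\<^bsub>local_binoid M p\<^esub>"
  by (simp add: laurent_def one_localization)

text \<open>Equality of fractions holds only up to a multiplier \<open>u\<close>. It is cancelled in
  the exponents rather than in \<open>M\<close>: as \<open>u\<close> lies off \<open>p\<close>, it
  is not \<open>infty M\<close> and is itself a monomial.\<close>

lemma laurent_inj:
  assumes p: "p \<in> prime_ideals M" and k: "supported_off p k" and l: "supported_off p l"
    and eq: "laurent p k = laurent p l" and i: "i \<in> I"
  shows "k i = l i"
proof -
  interpret S: submonoid "carrier M - p" M by (rule submonoid_compl_prime[OF p])
  have infty: "infty M \<in> p" using p by (simp add: prime_ideals_def)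
  obtain u where u: "u \<in> carrier M - p"
    "u \<otimes> (monomial (\<lambda>i. nat (k i)) \<otimes> monomial (\<lambda>i. nat (- l i))) =
     u \<otimes> (monomial (\<lambda>i. nat (l i)) \<otimes> monomial (\<lambda>i. nat (- k i)))"
    using eq monomial_off[OF p k] monomial_off[OF p l] unfolding laurent_def
    by (auto simp: fraction_eq_iff[OF submonoid_compl_prime[OF p]])
  moreover obtain w where w: "u = monomial w" using u infty by (auto elim: ex_monomial)
  ultimately have e: "monomial (\<lambda>i. w i + (nat (k i) + nat (- l i))) = monomial (\<lambda>i. w i + (nat (l i) + nat (- k i)))"
    by (simp add: monomial_mult)
  \<comment> \<open>The product stays off \<open>p\<close> while \<open>infty M\<close> lies in
    \<open>p\<close>. This rules out the one case in which equal monomials may have different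
    exponents.\<close>
  have "u \<otimes> (monomial (\<lambda>i. nat (k i)) \<otimes> monomial (\<lambda>i. nat (- l i))) \<in> carrier M - p"
    using u(1) monomial_off[OF p k] monomial_off[OF p l] by (intro S.m_closed)
  then have "monomial (\<lambda>i. w i + (nat (k i) + nat (- l i))) \<noteq> infty M"
    using infty by (auto simp: w monomial_mult)
  from exponent_unique[OF this e i] show ?thesis by linarith
qed

text \<open>The equation yields u a b = u f g with the right-hand side off \<open>p\<close>, and all
  divisors of an element off \<open>p\<close> are off \<open>p\<close>. Invertibility thus forces
  the exponents of the numerator to be supported off the prime.\<close>

lemma numerator_of_unit:
  assumes p: "p \<in> prime_ideals M" and a: "a \<in> carrier M" "f \<in> carrier M - p"
    and t: "t \<in> carrier (local_binoid M p)"
    and eq: "fraction M (carrier M - p) a f \<otimes>\<^bsub>local_binoid M p\<^esub> t = \<one>\<^bsub>local_binoid M p\<^esub>"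
  shows "a \<notin> p"
proof -
  note S = submonoid_compl_prime[OF p]
  interpret S: submonoid "carrier M - p" M by (rule S)
  obtain b g where b: "b \<in> carrier M" "g \<in> carrier M - p" "t = fraction M (carrier M - p) b g"
    using t unfolding carrier_localization by blast
  have fg: "f \<otimes> g \<in> carrier M - p" using a b by (intro S.m_closed)
  have "fraction M (carrier M - p) (a \<otimes> b) (f \<otimes> g) = fraction M (carrier M - p) \<one> \<one>"
    using eq a b by (simp add: mult_fraction[OF S] one_localization)
  then obtain u where u: "u \<in> carrier M - p" "u \<otimes> (a \<otimes> b \<otimes> \<one>) = u \<otimes> (\<one> \<otimes> (f \<otimes> g))"
    using fraction_eq_iff[OF S m_closed[OF a(1) b(1)] one_closed fg S.one_closed] by blast
  have "u \<otimes> (f \<otimes> g) \<in> carrier M - p" by (rule S.m_closed[OF u(1) fg])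
  moreover have "u \<otimes> (f \<otimes> g) = a \<otimes> (u \<otimes> b)"
    using u a b fg by (simp add: m_lcomm)
  ultimately have "a \<otimes> (u \<otimes> b) \<notin> p" by simp
  then show ?thesis using u(1) b(1) by (intro not_in_prime_dvd(1)[OF p a(1)]) simp_all
qed

section \<open>Sections given by locally constant exponents\<close>

lemma laurent_section:
  assumes U: "openin (Spec M) U" and off: "\<And>p. p \<in> U \<Longrightarrow> supported_off p (\<kappa> p)"
    and const: "\<And>p. p \<in> U \<Longrightarrow> \<exists>V. openin (Spec M) V \<and> p \<in> V \<and> V \<subseteq> U \<and> (\<forall>q \<in> V. \<forall>i \<in> I. \<kappa> q i = \<kappa> p i)"
  shows "(\<lambda>p \<in> U. laurent p (\<kappa> p)) \<in> carrier (sec (structure_sheaf M) U)"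
  unfolding carrier_structure_sheaf
proof (intro conjI ballI restrict_PiE_iff[THEN iffD2])
  fix p assume p: "p \<in> U"
  have prime: "q \<in> prime_ideals M" if "q \<in> U" for q using openin_subset[OF U] that by auto
  show "laurent p (\<kappa> p) \<in> carrier (local_binoid M p)"
    unfolding laurent_def using monomial_off[OF prime[OF p] off[OF p]] by (intro fraction_closed) auto
  obtain V where V: "openin (Spec M) V" "p \<in> V" "V \<subseteq> U" "\<forall>q \<in> V. \<forall>i \<in> I. \<kappa> q i = \<kappa> p i"
    using const[OF p] by blast
  have "monomial (\<lambda>i. nat (- \<kappa> p i)) \<notin> q \<and> (\<lambda>p \<in> U. laurent p (\<kappa> p)) q =
      fraction M (carrier M - q) (monomial (\<lambda>i. nat (\<kappa> p i))) (monomial (\<lambda>i. nat (- \<kappa> p i)))" if q: "q \<in> V" for q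
  proof -
    have qU: "q \<in> U" using q V by blast
    have eq: "\<kappa> q i = \<kappa> p i" if "i \<in> I" for i using V(4) q that by blast
    \<comment> \<open>The vector at \<open>p\<close> must give a legitimate denominator at every
      \<open>q\<close> of the neighbourhood. It does, since on \<open>I\<close> it agrees with the
      vector at \<open>q\<close>.\<close>
    have "supported_off q (\<kappa> p)" using off[OF qU] eq by (simp add: supported_off_def)
    moreover have "laurent q (\<kappa> q) = laurent q (\<kappa> p)" by (rule laurent_cong) (rule eq)
    ultimately show ?thesis using monomial_off(2)[OF prime[OF qU]] qU by (simp add: laurent_def)
  qed
  then show "\<exists>V. openin (Spec M) V \<and> p \<in> V \<and> V \<subseteq> U \<and> (\<exists>a \<in> carrier M. \<exists>f \<in> carrier M. \<forall>q \<in> V.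
      f \<notin> q \<and> (\<lambda>p \<in> U. laurent p (\<kappa> p)) q = fraction M (carrier M - q) a f)"
    using V(1-3) by (intro exI[of _ V] conjI bexI[of _ "monomial (\<lambda>i. nat (\<kappa> p i))"]
        bexI[of _ "monomial (\<lambda>i. nat (- \<kappa> p i))"] ballI) simp_all
qed

lemma laurent_section_mult:
  assumes U: "openin (Spec M) U" and k: "\<And>p. p \<in> U \<Longrightarrow> supported_off p (\<kappa> p)" and l: "\<And>p. p \<in> U \<Longrightarrow> supported_off p (\<mu> p)"
  shows "(\<lambda>p \<in> U. laurent p (\<kappa> p)) \<otimes>\<^bsub>sec (structure_sheaf M) U\<^esub> (\<lambda>p \<in> U. laurent p (\<mu> p)) =
    (\<lambda>p \<in> U. laurent p (\<lambda>i. \<kappa> p i + \<mu> p i))"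
  unfolding structure_sheaf_simps
proof (rule restrict_ext)
  fix p assume p: "p \<in> U"
  then have "p \<in> prime_ideals M" using openin_subset[OF U] by auto
  from laurent_mult[OF this k[OF p] l[OF p]] p
  show "restrict (\<lambda>p. laurent p (\<kappa> p)) U p \<otimes>\<^bsub>local_binoid M p\<^esub> restrict (\<lambda>p. laurent p (\<mu> p)) U p =
      laurent p (\<lambda>i. \<kappa> p i + \<mu> p i)" by simp
qed

lemma laurent_section_unit:
  assumes U: "openin (Spec M) U" and off: "\<And>p. p \<in> U \<Longrightarrow> supported_off p (\<kappa> p)"
    and const: "\<And>p. p \<in> U \<Longrightarrow> \<exists>V. openin (Spec M) V \<and> p \<in> V \<and> V \<subseteq> U \<and> (\<forall>q \<in> V. \<forall>i \<in> I. \<kappa> q i = \<kappa> p i)"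
  shows "(\<lambda>p \<in> U. laurent p (\<kappa> p)) \<in> Units (sec (structure_sheaf M) U)"
proof -
  let ?O = "sec (structure_sheaf M) U" and ?\<mu> = "\<lambda>p i. - \<kappa> p i"
  have off': "supported_off p (?\<mu> p)" if "p \<in> U" for p using off[OF that] by (simp add: supported_off_def)
  have "(\<lambda>p \<in> U. laurent p (?\<mu> p)) \<in> carrier ?O"
    by (rule laurent_section[OF U off']) (use const in simp_all)
  moreover have "(\<lambda>p \<in> U. laurent p (\<lambda>_. 0)) = \<one>\<^bsub>?O\<^esub>"
    by (simp add: structure_sheaf_simps laurent_zero)
  then have "(\<lambda>p \<in> U. laurent p (\<kappa> p)) \<otimes>\<^bsub>?O\<^esub> (\<lambda>p \<in> U. laurent p (?\<mu> p)) = \<one>\<^bsub>?O\<^esub>"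
      "(\<lambda>p \<in> U. laurent p (?\<mu> p)) \<otimes>\<^bsub>?O\<^esub> (\<lambda>p \<in> U. laurent p (\<kappa> p)) = \<one>\<^bsub>?O\<^esub>"
    using laurent_section_mult[OF U off off'] laurent_section_mult[OF U off' off] by simp_all
  ultimately show ?thesis
    using laurent_section[OF U off const] unfolding Units_def by blast
qed

text \<open>The vectors are chosen prime by prime, without regard to one another. Uniqueness
  restores local constancy: near each prime a single vector represents \<open>s\<close>, and by
  \<open>laurent_inj\<close> every vector chosen there agrees with it on \<open>I\<close>.\<close>

lemma unit_section_laurent:
  assumes U: "openin (Spec M) U" and s: "s \<in> Units (sec (structure_sheaf M) U)"
  obtains \<kappa> where "\<And>p. p \<in> U \<Longrightarrow> supported_off p (\<kappa> p)"
    and "\<And>p. p \<in> U \<Longrightarrow> \<exists>V. openin (Spec M) V \<and> p \<in> V \<and> V \<subseteq> U \<and> (\<forall>q \<in> V. \<forall>i \<in> I. \<kappa> q i = \<kappa> p i)"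
    and "s = (\<lambda>p \<in> U. laurent p (\<kappa> p))"
proof -
  let ?O = "sec (structure_sheaf M) U"
  have prime: "q \<in> prime_ideals M" if "q \<in> U" for q using openin_subset[OF U] that by auto
  obtain t where s_car: "s \<in> carrier ?O" and t: "t \<in> carrier ?O" "s \<otimes>\<^bsub>?O\<^esub> t = \<one>\<^bsub>?O\<^esub>"
    using s by (auto simp: Units_def)
  have local: "\<exists>V k. openin (Spec M) V \<and> p \<in> V \<and> V \<subseteq> U \<and> (\<forall>q \<in> V. supported_off q k \<and> s q = laurent q k)"
    if p: "p \<in> U" for p
  proof -
    obtain V a f where V: "openin (Spec M) V" "p \<in> V" "V \<subseteq> U" "a \<in> carrier M" "f \<in> carrier M"
      "\<forall>q \<in> V. f \<notin> q \<and> s q = fraction M (carrier M - q) a f"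
      using s_car p unfolding carrier_structure_sheaf by meson
    have a: "a \<notin> q" if q: "q \<in> V" for q
    proof -
      have qU: "q \<in> U" using q V by blast
      have "t q \<in> carrier (local_binoid M q)"
        using t(1) qU by (auto simp: carrier_structure_sheaf)
      moreover have "s q \<otimes>\<^bsub>local_binoid M q\<^esub> t q = \<one>\<^bsub>local_binoid M q\<^esub>"
        using fun_cong[OF t(2), of q] qU by (simp add: structure_sheaf_simps)
      ultimately show ?thesis
        using numerator_of_unit[OF prime[OF qU] V(4), of f "t q"] V(5,6) q by auto
    qed
    \<comment> \<open>Avoiding the single prime \<open>p\<close> already excludes
      \<open>infty M\<close>, so \<open>a\<close> and \<open>f\<close> are monomials, with exponents
      that serve on all of \<open>V\<close>.\<close>
    have "infty M \<in> p" using prime[OF p] by (simp add: prime_ideals_def)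
    then have "a \<noteq> infty M" "f \<noteq> infty M" using a V(2,6) by auto
    then obtain e g where eg: "a = monomial e" "f = monomial g" using ex_monomial V(4,5) by metis
    let ?k = "\<lambda>i. int (e i) - int (g i)"
    have "supported_off q ?k \<and> s q = laurent q ?k" if q: "q \<in> V" for q
    proof -
      have qp: "q \<in> prime_ideals M" using q V prime by blast
      have g: "monomial g \<notin> q" using V(6) q eg by blast
      have "supported_off q ?k"
        using a[OF q] g by (auto simp: supported_off_def eg monomial_notin_prime_iff[OF qp])
      then show ?thesis using laurent_eqI[OF qp _ g, of ?k e] V(6) q by (simp add: eg)
    qed
    with V show ?thesis by blast
  qed
  have "\<exists>k. supported_off p k \<and> s p = laurent p k" if "p \<in> U" for p
    using local[OF that] by metis
  then obtain \<kappa> where \<kappa>: "\<And>p. p \<in> U \<Longrightarrow> supported_off p (\<kappa> p)" "\<And>p. p \<in> U \<Longrightarrow> s p = laurent p (\<kappa> p)"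
    by metis
  show thesis
  proof (rule that[OF \<kappa>(1)])
    fix p assume p: "p \<in> U"
    obtain V k where V: "openin (Spec M) V" "p \<in> V" "V \<subseteq> U" "\<forall>q \<in> V. supported_off q k \<and> s q = laurent q k"
      using local[OF p] by blast
    have "\<kappa> q i = k i" if "q \<in> V" "i \<in> I" for q i
      using laurent_inj[OF prime \<kappa>(1), of q k i] \<kappa>(2)[of q] V(3,4) that by auto
    with V show "\<exists>V. openin (Spec M) V \<and> p \<in> V \<and> V \<subseteq> U \<and> (\<forall>q \<in> V. \<forall>i \<in> I. \<kappa> q i = \<kappa> p i)"
      by metis
  next
    show "s = (\<lambda>p \<in> U. laurent p (\<kappa> p))"
      using s_car \<kappa>(2) by (intro extensionalityI[of _ U]) (auto simp: carrier_structure_sheaf PiE_def)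
  qed
qed

end

section \<open>Extension by zero\<close>

lemma carrier_ext_zero_presheaf:
  "k \<in> carrier (sec (ext_zero_presheaf M f) U) \<longleftrightarrow> k = 0 \<or> U \<subseteq> basic_open M f"
  by (auto simp: ext_zero_presheaf_def)

lemma mult_ext_zero_presheaf:
  assumes "k \<in> carrier (sec (ext_zero_presheaf M f) U)" "l \<in> carrier (sec (ext_zero_presheaf M f) U)"
  shows "k \<otimes>\<^bsub>sec (ext_zero_presheaf M f) U\<^esub> l = k + l"
  using assms by (auto simp: ext_zero_presheaf_def singleton_group_def split: if_splits)

lemma res_ext_zero_presheaf: "res (ext_zero_presheaf M f) U V s = s"
  by (simp add: ext_zero_presheaf_def)

text \<open>Shrinking an open set can only enlarge the group of sections, so
  \<open>s \<mapsto> s\<close> is well defined. Locality fails already over the empty set, which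
  lies in D(f) and so carries all integers; hence the sheafification.\<close>

lemma ab_presheaf_ext_zero: "ab_presheaf X (ext_zero_presheaf M f)"
proof (intro ab_presheaf.intro presheaf.intro ab_presheaf_axioms.intro)
  fix U V :: "'a set set" and s :: int
  assume "V \<subseteq> U" "s \<in> carrier (sec (ext_zero_presheaf M f) U)"
  then show "res (ext_zero_presheaf M f) U V s \<in> carrier (sec (ext_zero_presheaf M f) V)"
    by (auto simp: res_ext_zero_presheaf carrier_ext_zero_presheaf)
next
  fix U :: "'a set set"
  show "comm_group (sec (ext_zero_presheaf M f) U)"
    by (simp add: ext_zero_presheaf_def abelian_integer_group)
next
  fix U V :: "'a set set"
  assume "V \<subseteq> U"
  then have *: "s \<in> carrier (sec (ext_zero_presheaf M f) V)" if "s \<in> carrier (sec (ext_zero_presheaf M f) U)" for s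
    using that by (auto simp: carrier_ext_zero_presheaf)
  then show "res (ext_zero_presheaf M f) U V \<in> hom (sec (ext_zero_presheaf M f) U) (sec (ext_zero_presheaf M f) V)"
    by (intro homI) (simp_all add: res_ext_zero_presheaf mult_ext_zero_presheaf)
qed (simp_all add: res_ext_zero_presheaf)

text \<open>The right-hand side does not depend on \<open>U\<close>, and \<open>k\<close> need not
  be a section over \<open>U\<close>. The expression
  \<open>germ X (ext_zero_presheaf M f) p U k\<close> thus names the germ of \<open>k\<close> at
  \<open>p\<close> even if \<open>U\<close> is not contained in D(f).\<close>

lemma germ_ext_zero:
  assumes "openin X U" "p \<in> U"
  shows "germ X (ext_zero_presheaf M f) p U k =
    {(V, t). openin X V \<and> p \<in> V \<and> t \<in> carrier (sec (ext_zero_presheaf M f) V) \<and> t = k}"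
proof -
  have "\<exists>W. openin X W \<and> p \<in> W \<and> W \<subseteq> U \<inter> V" if "openin X V" "p \<in> V" for V
    using assms that by (intro exI[of _ "U \<inter> V"]) auto
  then show ?thesis by (auto simp: germ_def res_ext_zero_presheaf)
qed

text \<open>
  All restriction maps are \<open>s \<mapsto> s\<close>, so every representative of a germ carries the same integer.
\<close>

definition germ_value :: "('p set \<times> int) set \<Rightarrow> int" where
  "germ_value A = snd (SOME z. z \<in> A)"

lemma germ_value_germ:
  assumes "openin X U" "p \<in> U" "k \<in> carrier (sec (ext_zero_presheaf M f) U)"
  shows "germ_value (germ X (ext_zero_presheaf M f) p U k) = k"
proof -
  let ?A = "germ X (ext_zero_presheaf M f) p U k"
  have "(U, k) \<in> ?A" using assms by (simp add: germ_ext_zero)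
  then have "(SOME z. z \<in> ?A) \<in> ?A" by (rule someI)
  then show ?thesis by (auto simp: germ_value_def germ_ext_zero[OF assms(1,2)])
qed

text \<open>A nonzero integer is a section only over open subsets of D(f), which gives the first
  claim. The second makes \<open>germ_value\<close> injective on a stalk.\<close>

lemma stalk_ext_zero:
  assumes A: "A \<in> carrier (stalk X (ext_zero_presheaf M f) p)"
  shows "germ_value A \<noteq> 0 \<Longrightarrow> p \<in> basic_open M f"
    and "openin X U \<Longrightarrow> p \<in> U \<Longrightarrow> A = germ X (ext_zero_presheaf M f) p U (germ_value A)"
proof -
  obtain V k where V: "openin X V" "p \<in> V" "k \<in> carrier (sec (ext_zero_presheaf M f) V)"
    "A = germ X (ext_zero_presheaf M f) p V k"
    using A by (auto simp: stalk_def)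
  have k: "germ_value A = k" unfolding V(4) by (rule germ_value_germ[OF V(1-3)])
  show "germ_value A \<noteq> 0 \<Longrightarrow> p \<in> basic_open M f"
    using V(2,3) by (auto simp: k carrier_ext_zero_presheaf)
  show "openin X U \<Longrightarrow> p \<in> U \<Longrightarrow> A = germ X (ext_zero_presheaf M f) p U (germ_value A)"
    unfolding k using V by (simp add: germ_ext_zero)
qed

lemma germ_value_mult:
  assumes "A \<in> carrier (stalk X (ext_zero_presheaf M f) p)" "B \<in> carrier (stalk X (ext_zero_presheaf M f) p)"
  shows "germ_value (A \<otimes>\<^bsub>stalk X (ext_zero_presheaf M f) p\<^esub> B) = germ_value A + germ_value B"
proof -
  interpret ab_presheaf X "ext_zero_presheaf M f" by (rule ab_presheaf_ext_zero)
  obtain W a b where W: "openin X W" "p \<in> W"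
    "a \<in> carrier (sec (ext_zero_presheaf M f) W)" "b \<in> carrier (sec (ext_zero_presheaf M f) W)"
    "A = germ X (ext_zero_presheaf M f) p W a" "B = germ X (ext_zero_presheaf M f) p W b"
    using common_nbhd[OF assms] .
  have "a + b \<in> carrier (sec (ext_zero_presheaf M f) W)"
    using W(3,4) by (auto simp: carrier_ext_zero_presheaf)
  then show ?thesis
    using W by (simp add: germ_mult_same mult_ext_zero_presheaf germ_value_germ)
qed

lemma sheafification_ext_zero_locally_constant:
  assumes s: "\<sigma> \<in> carrier (sec (sheafification X (ext_zero_presheaf M f)) U)" and p: "p \<in> U"
  shows "\<exists>V. openin X V \<and> p \<in> V \<and> V \<subseteq> U \<and> (\<forall>q \<in> V. germ_value (\<sigma> q) = germ_value (\<sigma> p))"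
proof -
  interpret ab_presheaf X "ext_zero_presheaf M f" by (rule ab_presheaf_ext_zero)
  obtain V t where V: "openin X V" "p \<in> V" "V \<subseteq> U" "t \<in> carrier (sec (ext_zero_presheaf M f) V)"
      "\<forall>q \<in> V. \<sigma> q = germ X (ext_zero_presheaf M f) q V t"
    using s p unfolding carrier_sheafification by blast
  then have "germ_value (\<sigma> q) = t" if "q \<in> V" for q
    using that by (simp add: germ_value_germ)
  with V show ?thesis by metis
qed

text \<open>The integer \<open>\<kappa> p\<close> is a section only over a smaller neighbourhood of
  \<open>p\<close>; the \<open>U\<close> inside \<open>\<sigma>\<close> merely completes the name of
  the germ, as \<open>germ_ext_zero\<close> permits.\<close>

lemma germ_section:
  assumes U: "openin X U"
    and const: "\<And>p. p \<in> U \<Longrightarrow> \<exists>V. openin X V \<and> p \<in> V \<and> V \<subseteq> U \<and> (\<forall>q \<in> V. \<kappa> q = \<kappa> p)"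
    and supp: "\<And>p. p \<in> U \<Longrightarrow> \<kappa> p \<noteq> 0 \<Longrightarrow> p \<in> basic_open M f"
  defines "\<sigma> \<equiv> \<lambda>p \<in> U. germ X (ext_zero_presheaf M f) p U (\<kappa> p)"
  shows "\<sigma> \<in> carrier (sec (sheafification X (ext_zero_presheaf M f)) U)"
    and "p \<in> U \<Longrightarrow> germ_value (\<sigma> p) = \<kappa> p"
proof -
  interpret ab_presheaf X "ext_zero_presheaf M f" by (rule ab_presheaf_ext_zero)
  have local: "\<exists>V. openin X V \<and> p \<in> V \<and> V \<subseteq> U \<and> \<kappa> p \<in> carrier (sec (ext_zero_presheaf M f) V) \<and>
      (\<forall>q \<in> V. \<sigma> q = germ X (ext_zero_presheaf M f) q V (\<kappa> p))" if p: "p \<in> U" for p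
  proof -
    obtain V where V: "openin X V" "p \<in> V" "V \<subseteq> U" "\<forall>q \<in> V. \<kappa> q = \<kappa> p" using const[OF p] by blast
    have "\<sigma> q = germ X (ext_zero_presheaf M f) q V (\<kappa> p)" if "q \<in> V" for q
    proof -
      have "\<kappa> q = \<kappa> p" "q \<in> U" using V(3,4) that by auto
      then show ?thesis using U V(1) that by (simp add: \<sigma>_def germ_ext_zero)
    qed
    moreover have "\<kappa> p \<in> carrier (sec (ext_zero_presheaf M f) V)"
    proof (cases "\<kappa> p = 0")
      case False
      \<comment> \<open>By constancy on \<open>V\<close>, a nonzero value at \<open>p\<close> is
        nonzero on all of \<open>V\<close>, and \<open>supp\<close> places \<open>V\<close> inside
        D(f).\<close>
      have "q \<in> basic_open M f" if "q \<in> V" for q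
        using supp[of q] V(3) V(4)[rule_format, OF that] False that by auto
      then show ?thesis by (auto simp: carrier_ext_zero_presheaf)
    qed (simp add: carrier_ext_zero_presheaf)
    ultimately show ?thesis using V(1-3) by blast
  qed
  moreover have "\<sigma> \<in> extensional U" by (simp add: \<sigma>_def)
  ultimately show "\<sigma> \<in> carrier (sec (sheafification X (ext_zero_presheaf M f)) U)"
    unfolding carrier_sheafification by meson
  show "germ_value (\<sigma> p) = \<kappa> p" if "p \<in> U"
    using local[OF that] by (auto simp: germ_value_germ)
qed

section \<open>The isomorphism\<close>

context semifree_binoid
begin

definition exponents :: "('i \<Rightarrow> 'a set \<Rightarrow> ('a set set \<times> int) set) \<Rightarrow> 'a set \<Rightarrow> 'i \<Rightarrow> int" where
  "exponents \<sigma> p i = germ_value (\<sigma> i p)"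

definition laurent_map ::
    "'a set set \<Rightarrow> ('i \<Rightarrow> 'a set \<Rightarrow> ('a set set \<times> int) set) \<Rightarrow> 'a set \<Rightarrow> ('a \<times> 'a) set" where
  "laurent_map U \<sigma> = (\<lambda>p \<in> U. laurent p (exponents \<sigma> p))"

lemma ext_zero_direct_sum_iso:
  "ab_sheaf_iso (punctured_Spec M) (direct_sum I (\<lambda>i. ext_zero_sheaf M (x i))) (units_sheaf M) laurent_map"
proof -
  let ?X = "punctured_Spec M" and ?E = "\<lambda>i. ext_zero_presheaf M (x i)"
  let ?D = "direct_sum I (\<lambda>i. ext_zero_sheaf M (x i))" and ?O = "structure_sheaf M"
  have open_iff: "openin ?X V \<longleftrightarrow> openin (Spec M) V \<and> V \<subseteq> prime_ideals M - {max_ideal M}" for V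
    unfolding punctured_Spec_def by (rule openin_open_subtopology[OF openin_punctured_Spec])
  have prime: "p \<in> prime_ideals M" if "openin ?X U" "p \<in> U" for U p
    using that by (auto simp: open_iff)
  have psh: "ab_presheaf ?X (?E i)" for i by (rule ab_presheaf_ext_zero)
  have E: "ab_sheaf ?X (ext_zero_sheaf M (x i))" for i
    unfolding ext_zero_sheaf_def by (rule ab_presheaf.ab_sheaf_sheafification[OF psh])
  have D: "ab_sheaf ?X ?D" using finite_I E by (rule ab_sheaf_direct_sum)
  have units: "ab_sheaf ?X (units_sheaf M)"
    unfolding units_sheaf_def punctured_Spec_def
    by (intro ab_sheaf_units_presheaf binoid_sheaf_open_subspace binoid_sheaf_structure_sheaf
        openin_punctured_Spec)
  have car_D: "carrier (sec ?D U) = (\<Pi>\<^sub>E i\<in>I. carrier (sec (sheafification ?X (?E i)) U))"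
    if "openin ?X U" for U
    using comm_group.axioms(2)[OF ab_sheaf.sec_comm_group[OF E that]]
    by (simp add: direct_sum_def carrier_sum_group ext_zero_sheaf_def)
  have car_U: "carrier (sec (units_sheaf M) U) = Units (sec ?O U)" for U
    by (simp add: units_sheaf_def units_presheaf_def units_of_carrier)
  have comp: "\<sigma> i \<in> carrier (sec (sheafification ?X (?E i)) U)"
    if "openin ?X U" "\<sigma> \<in> carrier (sec ?D U)" "i \<in> I" for U \<sigma> i
    using that by (auto simp: car_D)
  have stalk: "\<sigma> i p \<in> carrier (stalk ?X (?E i) p)"
    if "openin ?X U" "\<sigma> \<in> carrier (sec ?D U)" "i \<in> I" "p \<in> U" for U \<sigma> i p
    using ab_presheaf.sheafification_value[OF psh comp] that by blast
  have off_exp: "supported_off p (exponents \<sigma> p)"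
    if "openin ?X U" "\<sigma> \<in> carrier (sec ?D U)" "p \<in> U" for U \<sigma> p
    unfolding supported_off_def exponents_def
  proof (intro ballI impI)
    fix i assume i: "i \<in> I" "germ_value (\<sigma> i p) \<noteq> 0"
    have "p \<in> basic_open M (x i)"
      by (rule stalk_ext_zero(1)[OF stalk[OF that(1,2) i(1) that(3)] i(2)])
    then show "x i \<notin> p" by (simp add: basic_open_def)
  qed
  have const_exp: "\<exists>V. openin (Spec M) V \<and> p \<in> V \<and> V \<subseteq> U \<and> (\<forall>q \<in> V. \<forall>i \<in> I. exponents \<sigma> q i = exponents \<sigma> p i)"
    if U: "openin ?X U" "\<sigma> \<in> carrier (sec ?D U)" "p \<in> U" for U \<sigma> p
  proof -
    have "\<exists>V. openin ?X V \<and> p \<in> V \<and> V \<subseteq> U \<and> (\<forall>q \<in> V. exponents \<sigma> q i = exponents \<sigma> p i)" if "i \<in> I" for i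
      unfolding exponents_def
      by (rule sheafification_ext_zero_locally_constant[OF comp[OF U(1,2) that] U(3)])
    then obtain V where V: "\<And>i. i \<in> I \<Longrightarrow> openin ?X (V i)" "\<And>i. i \<in> I \<Longrightarrow> p \<in> V i"
        "\<And>i q. \<lbrakk>i \<in> I; q \<in> V i\<rbrakk> \<Longrightarrow> exponents \<sigma> q i = exponents \<sigma> p i"
      by metis
    \<comment> \<open>For empty \<open>I\<close> the intersection is the whole type, which need not
      be open, so it is cut down to the space. Finiteness of \<open>I\<close> keeps it open.\<close>
    let ?W = "U \<inter> ((\<Inter>i \<in> I. V i) \<inter> topspace ?X)"
    have "openin ?X ?W" by (intro openin_Int U(1) openin_INT finite_I V(1))
    then have "openin (Spec M) ?W" unfolding open_iff by (rule conjunct1)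
    moreover have "p \<in> ?W" "?W \<subseteq> U" using U(3) V(2) openin_subset[OF U(1)] by blast+
    moreover have "\<forall>q \<in> ?W. \<forall>i \<in> I. exponents \<sigma> q i = exponents \<sigma> p i" using V(3) by blast
    ultimately show ?thesis by blast
  qed
  have inj: "inj_on (laurent_map U) (carrier (sec ?D U))" if U: "openin ?X U" for U
  proof (rule inj_onI)
    fix \<sigma> \<tau> assume st: "\<sigma> \<in> carrier (sec ?D U)" "\<tau> \<in> carrier (sec ?D U)"
      and eq: "laurent_map U \<sigma> = laurent_map U \<tau>"
    show "\<sigma> = \<tau>"
    proof (rule PiE_ext[OF st[unfolded car_D[OF U]]])
      fix i assume i: "i \<in> I"
      show "\<sigma> i = \<tau> i"
      proof (rule extensionalityI[of _ U])
        show "\<sigma> i \<in> extensional U" "\<tau> i \<in> extensional U"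
          using comp[OF U _ i] st ab_presheaf.carrier_sheafification[OF psh] by blast+
        fix p assume p: "p \<in> U"
        from fun_cong[OF eq, of p] p have "laurent p (exponents \<sigma> p) = laurent p (exponents \<tau> p)"
          by (simp add: laurent_map_def)
        from laurent_inj[OF prime[OF U p] off_exp[OF U st(1) p] off_exp[OF U st(2) p] this i]
        have "germ_value (\<sigma> i p) = germ_value (\<tau> i p)" by (simp add: exponents_def)
        \<comment> \<open>Both germs are named by their values over the same \<open>U\<close>, so
          equal values force equal germs.\<close>
        then show "\<sigma> i p = \<tau> i p"
          using stalk_ext_zero(2)[OF stalk[OF U _ i p] U p] st by metis
      qed
    qed
  qed
  have surj: "laurent_map U ` carrier (sec ?D U) = Units (sec ?O U)" if U: "openin ?X U" for U
  proof
    show "laurent_map U ` carrier (sec ?D U) \<subseteq> Units (sec ?O U)"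
      unfolding laurent_map_def
    proof (rule image_subsetI)
      fix \<sigma> assume \<sigma>: "\<sigma> \<in> carrier (sec ?D U)"
      show "(\<lambda>p \<in> U. laurent p (exponents \<sigma> p)) \<in> Units (sec ?O U)"
        by (rule laurent_section_unit[OF _ off_exp[OF U \<sigma>] const_exp[OF U \<sigma>]])
          (use U in \<open>simp add: open_iff\<close>)
    qed
    show "Units (sec ?O U) \<subseteq> laurent_map U ` carrier (sec ?D U)"
    proof
      fix s assume s: "s \<in> Units (sec ?O U)"
      have U': "openin (Spec M) U" using U by (simp add: open_iff)
      obtain \<kappa> where \<kappa>: "\<And>p. p \<in> U \<Longrightarrow> supported_off p (\<kappa> p)"
          "\<And>p. p \<in> U \<Longrightarrow> \<exists>V. openin (Spec M) V \<and> p \<in> V \<and> V \<subseteq> U \<and> (\<forall>q \<in> V. \<forall>i \<in> I. \<kappa> q i = \<kappa> p i)"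
          "s = (\<lambda>p \<in> U. laurent p (\<kappa> p))"
        using unit_section_laurent[OF U' s] by blast
      \<comment> \<open>The preimage turns each exponent at \<open>p\<close> into a germ at
        \<open>p\<close>. Support of \<open>\<kappa> p\<close> off \<open>p\<close> becomes
        vanishing outside D(x_i).\<close>
      define \<sigma> where "\<sigma> = (\<lambda>i \<in> I. \<lambda>p \<in> U. germ ?X (?E i) p U (\<kappa> p i))"
      have const: "\<exists>V. openin ?X V \<and> p \<in> V \<and> V \<subseteq> U \<and> (\<forall>q \<in> V. \<kappa> q i = \<kappa> p i)" if p: "p \<in> U" and i: "i \<in> I" for p i
      proof -
        obtain V where V: "openin (Spec M) V" "p \<in> V" "V \<subseteq> U" "\<forall>q \<in> V. \<forall>i \<in> I. \<kappa> q i = \<kappa> p i"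
          using \<kappa>(2)[OF p] by blast
        then have "openin ?X V" using U by (auto simp only: open_iff)
        with V i show ?thesis by blast
      qed
      have supp: "p \<in> basic_open M (x i)" if "p \<in> U" "i \<in> I" "\<kappa> p i \<noteq> 0" for p i
        using \<kappa>(1)[OF that(1)] that prime[OF U that(1)] by (auto simp: supported_off_def basic_open_def)
      have "\<sigma> \<in> carrier (sec ?D U)"
        using germ_section(1)[OF U const supp] by (auto simp: car_D[OF U] \<sigma>_def)
      moreover have "exponents \<sigma> p i = \<kappa> p i" if "p \<in> U" "i \<in> I" for p i
        using germ_section(2)[OF U const[OF _ that(2)] supp[OF _ that(2)] that(1)] that
        by (simp add: exponents_def \<sigma>_def)
      then have "laurent p (exponents \<sigma> p) = laurent p (\<kappa> p)" if "p \<in> U" for p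
        using that by (intro laurent_cong) simp
      then have "laurent_map U \<sigma> = s"
        unfolding laurent_map_def \<kappa>(3) by (rule restrict_ext)
      ultimately show "s \<in> laurent_map U ` carrier (sec ?D U)" by blast
    qed
  qed
  have hom: "laurent_map U (\<sigma> \<otimes>\<^bsub>sec ?D U\<^esub> \<tau>) = laurent_map U \<sigma> \<otimes>\<^bsub>sec (units_sheaf M) U\<^esub> laurent_map U \<tau>"
    if U: "openin ?X U" and st: "\<sigma> \<in> carrier (sec ?D U)" "\<tau> \<in> carrier (sec ?D U)" for U \<sigma> \<tau>
  proof -
    have exp: "exponents (\<sigma> \<otimes>\<^bsub>sec ?D U\<^esub> \<tau>) p i = exponents \<sigma> p i + exponents \<tau> p i" if "p \<in> U" "i \<in> I" for p i
    proof -
      have "(\<sigma> \<otimes>\<^bsub>sec ?D U\<^esub> \<tau>) i p = \<sigma> i p \<otimes>\<^bsub>stalk ?X (?E i) p\<^esub> \<tau> i p"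
        using that by (simp add: direct_sum_def ext_zero_sheaf_def ab_presheaf.sheafification_simps[OF psh])
      then show ?thesis
        using germ_value_mult[OF stalk[OF U st(1) that(2,1)] stalk[OF U st(2) that(2,1)]]
        by (simp add: exponents_def)
    qed
    have "laurent_map U (\<sigma> \<otimes>\<^bsub>sec ?D U\<^esub> \<tau>) = (\<lambda>p \<in> U. laurent p (\<lambda>i. exponents \<sigma> p i + exponents \<tau> p i))"
      unfolding laurent_map_def by (intro restrict_ext laurent_cong exp)
    also have "\<dots> = laurent_map U \<sigma> \<otimes>\<^bsub>sec ?O U\<^esub> laurent_map U \<tau>"
      unfolding laurent_map_def
      using U off_exp[OF U st(1)] off_exp[OF U st(2)]
      by (intro laurent_section_mult[symmetric]) (auto simp: open_iff)
    also have "\<dots> = laurent_map U \<sigma> \<otimes>\<^bsub>sec (units_sheaf M) U\<^esub> laurent_map U \<tau>"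
      by (simp add: units_sheaf_def units_presheaf_def units_of_mult)
    finally show ?thesis .
  qed
  have "laurent_map U \<in> iso (sec ?D U) (sec (units_sheaf M) U)" if "openin ?X U" for U
    using inj[OF that] surj[OF that] hom[OF that]
    by (intro isoI homI) (auto simp: bij_betw_def car_U)
  moreover have "laurent_map V (res ?D U V \<sigma>) = res (units_sheaf M) U V (laurent_map U \<sigma>)"
    if "V \<subseteq> U" for U V \<sigma>
  proof -
    \<comment> \<open>Exponents at \<open>p\<close> involve only the values at \<open>p\<close>, so
      restriction leaves them untouched.\<close>
    have "exponents (res ?D U V \<sigma>) p i = exponents \<sigma> p i" if "p \<in> V" "i \<in> I" for p i
      using that
      by (simp add: exponents_def direct_sum_def ext_zero_sheaf_def ab_presheaf.sheafification_simps[OF psh])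
    then have "laurent_map V (res ?D U V \<sigma>) = (\<lambda>p \<in> V. laurent p (exponents \<sigma> p))"
      unfolding laurent_map_def by (intro restrict_ext laurent_cong)
    also have "\<dots> = restrict (laurent_map U \<sigma>) V"
      using that by (simp add: laurent_map_def Int_absorb1)
    finally show ?thesis by (simp add: units_sheaf_def units_presheaf_def structure_sheaf_simps)
  qed
  ultimately show ?thesis unfolding ab_sheaf_iso_def using D units by blast
qed

end

theorem theorem2p39:
  fixes M :: "('a, 'm) binoid_scheme" and n :: nat and x :: "nat \<Rightarrow> 'a"
  assumes "comm_binoid M"
    and "positive_binoid M"
    and "semifree M {1..n} x"
  shows "\<exists>\<phi>. ab_sheaf_iso (punctured_Spec M)
               (direct_sum {1..n} (\<lambda>i. ext_zero_sheaf M (x i))) (units_sheaf M) \<phi>"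
proof -
  interpret semifree_binoid M "{1..n}" x
    by (intro semifree_binoid.intro semifree_binoid_axioms.intro assms(1,3)) simp
  show ?thesis using ext_zero_direct_sum_iso by blast
qed

end
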